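(* Consider the problem $\min_{x\in\mathcal{X}} h(x)$ and the PSCA iterates $\{x^r\}$ described in the context. Assume $\gamma^r\in(0,1]$ for all $r$, $\sum_{r=1}^{\infty}\gamma^r=+\infty$, and $$\limsup_{r\to\infty}\gamma^r<\bar\gamma:=\min\left\{\frac{\tau}{L_{\nabla f}},\ \frac{\tau}{\tau+\widetilde{L}\sqrt{n}}\right\}.$$ Suppose that either the cyclic or the randomized block selection rule is employed; for the cyclic rule, assume further that $\{\gamma^r\}_{r=1}^{\infty}$ is monotonically decreasing (nonincreasing). Then every limit point of the iterates $\{x^r\}$ is a stationary point of the problem $\min_{x\in\mathcal{X}}h(x)$: deterministically for the cyclic rule, and almost surely for the randomized rule.
   Context: Problem: minimize $h(x)=f(x_1,\dots,x_n)+\sum_{i=1}^n g_i(x_i)$ subject to $x_i\in\mathcal{X}_i$, $i=1,\dots,n$, where each $\mathcal{X}_i\subseteq\mathbb{R}^{m_i}$ is a (nonempty) closed convex set, $\mathcal{X}=\prod_{i=1}^n\mathcal{X}_i$, $f:\mathcal{X}\to\mathbb{R}$ is continuously differentiable (possibly nonconvex), each $g_i:\mathbb{R}^{m_i}\to\mathbb{R}$ is convex (possibly nonsmooth), and $g(x)=\sum_i g_i(x_i)$. $\|\cdot\|$ is the Euclidean norm. Assume $\|\nabla f(x)-\nabla f(y)\|\le L_{\nabla f}\|x-y\|$ for all $x,y\in\mathcal{X}$, and $\inf_{x\in\mathcal{X}}h(x)>-\infty$. Stationary point: $\bar x\in\mathcal{X}$ is stationary if there is $d\in\partial g(\bar x)$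 with $\langle\nabla f(\bar x)+d,x-\bar x\rangle\ge 0$ for all $x\in\mathcal{X}$. Approximations: for each $i$ a function $\widetilde f_i:\mathcal{X}_i\times\mathcal{X}\to\mathbb{R}$ is given such that (1) $\widetilde f_i(\cdot,y)$ is continuously differentiable and uniformly strongly convex with parameter $\tau>0$: $\widetilde f_i(x_i,y)\ge\widetilde f_i(x_i',y)+\langle\nabla_{x_i}\widetilde f_i(x_i',y),x_i-x_i'\rangle+\frac{\tau}{2}\|x_i-x_i'\|^2$ for all $x_i,x_i'\in\mathcal{X}_i$, $y\in\mathcal{X}$; (2) (gradient consistency) $\nabla_{x_i}\widetilde f_i(x_i,x)=\nabla_{x_i}f(x)$ for all $x\in\mathcal{X}$, where $x_i$ is the $i$-th block of $x$ and the gradient of $\widetilde f_i$ is with respect to its first argument; (3) $\|\nabla_{x_i}\widetilde f_i(x_i,y)-\nabla_{x_i}\widetilde f_i(x_i,z)\|\le\widetilde L\|y-z\|$ for all $y,z\in\mathcal{X}$, $x_i\in\mathcal{X}_i$, and all $i$. Put $\widetilde h_i(x_i,y)=\widetilde f_i(x_i,y)+g_i(x_i)$. PSCA algorithm: start from a feasible $x^0\in\mathcal{X}$. For $r=0,1,2,\dots$: choose $S^r\subseteq\{1,\dots,n\}$; let $\hat x_i^r=\arg\min_{x_i\in\mathcal{X}_i}\widetilde h_i(x_i,x^r)$; set $x_i^{r+1}=x_i^r+\gamma^r(\hat x_i^r-x_i^r)$ for $i\in S^r$ and $x_i^{r+1}=x_i^r$ for $i\notin S^r$, where $\gamma^r$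 is the step-size. Cyclic rule: a partition $\{\mathcal{T}_0,\dots,\mathcal{T}_{m-1}\}$ of $\{1,\dots,n\}$ into pairwise disjoint sets is fixed and $S^{mr+\ell}=\mathcal{T}_\ell$ for all $\ell=0,\dots,m-1$ and all $r$. Randomized rule: the sets $S^r$ are random with $\Pr(j\in S^r\mid x^r,x^{r-1},\dots,x^0)=p_j^r\ge p_{\min}>0$ for all $j=1,\dots,n$ and all $r$. *)

theory Defs
  imports "HOL-Probability.Probability"
begin

text \<open>
  The ambient space \<open>real ^ 'k\<close> is the product of the block spaces; \<open>blk k\<close> is the block to which
  coordinate \<open>k\<close> belongs. The space of the \<open>i\<close>-th block, of dimension \<open>card {k. blk k = i}\<close>
  (different blocks may have different dimensions), is the coordinate subspace
  \<open>block_space blk i\<close>, and the \<open>i\<close>-th block of \<open>x\<close> is its coordinate projection.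
\<close>

definition block_space :: "('k::finite \<Rightarrow> 'n::finite) \<Rightarrow> 'n \<Rightarrow> (real ^ 'k) set" where
  "block_space blk i = {v. \<forall>k. blk k \<noteq> i \<longrightarrow> v $ k = 0}"

definition block :: "('k::finite \<Rightarrow> 'n::finite) \<Rightarrow> 'n \<Rightarrow> real ^ 'k \<Rightarrow> real ^ 'k" where
  "block blk i x = (\<chi> k. if blk k = i then x $ k else 0)"

definition feasible :: "('k::finite \<Rightarrow> 'n::finite) \<Rightarrow> ('n \<Rightarrow> (real ^ 'k) set) \<Rightarrow> (real ^ 'k) set" where
  "feasible blk X = {x. \<forall>i. block blk i x \<in> X i}"

definition separable_sum ::
  "('k::finite \<Rightarrow> 'n::finite) \<Rightarrow> ('n \<Rightarrow> real ^ 'k \<Rightarrow> real) \<Rightarrow> real ^ 'k \<Rightarrow> real" where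
  "separable_sum blk g x = (\<Sum>i\<in>UNIV. g i (block blk i x))"

text \<open>
  The derivative is taken within \<open>A\<close>, so that a function given on \<open>A\<close> only is covered. If \<open>A\<close> has
  empty interior, \<open>G\<close> need not be unique; it is therefore a parameter. A function that is
  continuously differentiable on an open neighbourhood of \<open>A\<close> satisfies this with its gradient.
\<close>

definition C1_on_with_gradient ::
  "'a::euclidean_space set \<Rightarrow> ('a \<Rightarrow> real) \<Rightarrow> ('a \<Rightarrow> 'a) \<Rightarrow> bool" where
  "C1_on_with_gradient A \<phi> G \<longleftrightarrow>
     (\<forall>x\<in>A. (\<phi> has_derivative (\<lambda>v. G x \<bullet> v)) (at x within A)) \<and> continuous_on A G"

definition subdifferential :: "('a::euclidean_space \<Rightarrow> real) \<Rightarrow> 'a \<Rightarrow> 'a set" where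
  "subdifferential \<phi> x = {d. \<forall>y. \<phi> y \<ge> \<phi> x + d \<bullet> (y - x)}"

definition stationary ::
  "'a::euclidean_space set \<Rightarrow> ('a \<Rightarrow> 'a) \<Rightarrow> ('a \<Rightarrow> real) \<Rightarrow> 'a \<Rightarrow> bool" where
  "stationary A gradf g z \<longleftrightarrow>
     z \<in> A \<and> (\<exists>d\<in>subdifferential g z. \<forall>x\<in>A. (gradf z + d) \<bullet> (x - z) \<ge> 0)"

definition seq_limit_point :: "(nat \<Rightarrow> 'a::topological_space) \<Rightarrow> 'a \<Rightarrow> bool" where
  "seq_limit_point x z \<longleftrightarrow> (\<exists>s. strict_mono s \<and> (x \<circ> s) \<longlonglongrightarrow> z)"

definition psca_iterates ::
  "('k::finite \<Rightarrow> 'n::finite) \<Rightarrow> ('n \<Rightarrow> (real ^ 'k) set) \<Rightarrow>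
   ('n \<Rightarrow> real ^ 'k \<Rightarrow> real ^ 'k \<Rightarrow> real) \<Rightarrow> ('n \<Rightarrow> real ^ 'k \<Rightarrow> real) \<Rightarrow>
   (nat \<Rightarrow> real) \<Rightarrow> real ^ 'k \<Rightarrow> (nat \<Rightarrow> 'n set) \<Rightarrow> (nat \<Rightarrow> real ^ 'k) \<Rightarrow> bool" where
  "psca_iterates blk X ft g \<gamma> x0 S x \<longleftrightarrow>
     x 0 = x0 \<and>
     (\<forall>r i. \<exists>xhat. is_arg_min (\<lambda>u. ft i u (x r) + g i u) (\<lambda>u. u \<in> X i) xhat \<and>
        block blk i (x (Suc r)) =
          (if i \<in> S r then block blk i (x r) + \<gamma> r *\<^sub>R (xhat - block blk i (x r))
           else block blk i (x r)))"

definition cyclic_rule :: "(nat \<Rightarrow> 'n set) \<Rightarrow> bool" where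
  "cyclic_rule S \<longleftrightarrow>
     (\<exists>m T. m > 0 \<and> disjoint_family_on T {..<m} \<and> (\<Union>l<m. T l) = UNIV \<and>
        (\<forall>r. \<forall>l<m. S (m * r + l) = T l))"

text \<open>The \<open>\<sigma>\<close>-algebra generated by \<open>x 0, \<dots>, x r\<close>.\<close>

definition history :: "'w measure \<Rightarrow> (nat \<Rightarrow> 'w \<Rightarrow> 'a::topological_space) \<Rightarrow> nat \<Rightarrow> 'w measure" where
  "history M x r = sigma (space M) {x k -` B \<inter> space M | k B. k \<le> r \<and> B \<in> sets borel}"

text \<open>
  The conditional selection probabilities \<open>p r j\<close> may depend on the outcome; constants are a
  special case.
\<close>

definition randomized_rule ::
  "'w measure \<Rightarrow> (nat \<Rightarrow> 'w \<Rightarrow> 'n set) \<Rightarrow> (nat \<Rightarrow> 'w \<Rightarrow> 'a::topological_space) \<Rightarrow> bool" where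
  "randomized_rule M S x \<longleftrightarrow>
     (\<forall>r. S r \<in> measurable M (count_space UNIV)) \<and>
     (\<forall>r. x r \<in> borel_measurable M) \<and>
     (\<exists>p pmin. pmin > 0 \<and>
        (\<forall>r j. AE \<omega> in M.
           real_cond_exp M (history M x r) (indicat_real {\<omega> \<in> space M. j \<in> S r \<omega>}) \<omega> = p r j \<omega> \<and>
           p r j \<omega> \<ge> pmin))"

end

theory Submission
  imports Defs
begin

text \<open>
  Let \<open>D r\<close> be the vector of differences between the block minimisers at \<open>x r\<close> and \<open>x r\<close> itself.
  Strong convexity makes it a descent direction in every block, so once \<open>\<gamma> r < \<tau> / L\<close> the objective
  decreases by at least a multiple of \<open>\<gamma> r\<close> times the squared norm of the selected part of \<open>D r\<close>,
  and these decreases are summable. Passing to windows of \<open>m\<close> steps (cyclic rule) or to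
  expectations (randomized rule) gives the same for all blocks. As \<open>D r\<close> is Lipschitz in \<open>x r\<close>, it
  varies by at most a multiple of \<open>\<gamma> r * norm (D r)\<close> per step; since the step sizes are not summable,
  it cannot return infinitely often to a positive level, and so \<open>D r\<close> tends to 0. At a limit point the
  variational inequalities of the blocks combine into stationarity, a separating hyperplane providing
  the subgradient.
\<close>

section \<open>Real sequences\<close>

text \<open>Divergence of \<open>\<beta>\<close> forces \<open>v\<close> below every positive level
  infinitely often, and each climb from \<open>a / 2\<close> back to \<open>a\<close> uses up a
  fixed amount of variation. Inside that band the variation is dominated by a convergent series, so
  only finitely many climbs occur.\<close>

lemma vanishing_of_slow_variation:
  fixes v \<beta> \<epsilon> :: "nat \<Rightarrow> real"
  assumes v: "\<And>r. v r \<ge> 0" and \<beta>: "\<And>r. \<beta> r \<ge> 0" and \<epsilon>: "\<And>r. \<epsilon> r \<ge> 0" and C: "C \<ge> 0"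
    and div: "\<not> summable \<beta>" and sq: "summable (\<lambda>r. \<beta> r * (v r)\<^sup>2)" and sum\<epsilon>: "summable \<epsilon>"
    and var: "\<And>r. \<bar>v (Suc r) - v r\<bar> \<le> (C * \<beta> r + \<epsilon> r) * v r"
    and small: "(\<lambda>r. v (Suc r) - v r) \<longlonglongrightarrow> 0"
  shows "v \<longlonglongrightarrow> 0"
proof (rule order_tendstoI)
  fix a :: real assume "a < 0"
  then show "\<forall>\<^sub>F r in sequentially. a < v r" using v by (intro always_eventually allI) (rule less_le_trans)
next
  fix a :: real assume a: "0 < a"
  define \<delta> where "\<delta> = a / 2"
  have \<delta>: "\<delta> > 0" using a by (simp add: \<delta>_def)
  define u where "u r = max \<delta> (min (v r) (2 * \<delta>))" for r
  have "\<forall>\<^sub>F r in sequentially. \<bar>v (Suc r) - v r\<bar> < \<delta> / 2"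
    using tendstoD[OF small, of "\<delta> / 2"] \<delta> by (simp add: dist_real_def)
  then obtain r0 where r0: "\<And>r. r \<ge> r0 \<Longrightarrow> \<bar>v (Suc r) - v r\<bar> < \<delta> / 2"
    by (auto simp: eventually_sequentially)
  \<comment> \<open>The truncation \<open>u\<close> moves only while \<open>v\<close> is comparable to \<open>\<delta>\<close>, where \<open>v r \<le> 2 / \<delta> * (v r)\<^sup>2\<close>.\<close>
  have bound: "\<bar>u (Suc r) - u r\<bar> \<le> 2 * C / \<delta> * (\<beta> r * (v r)\<^sup>2) + 3 * \<delta> * \<epsilon> r" if "r \<ge> r0" for r
  proof (cases "u (Suc r) = u r")
    case True
    then show ?thesis using \<beta>[of r] \<epsilon>[of r] C \<delta> by simp
  next
    case False
    have lo: "\<delta> / 2 \<le> v r"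
    proof (rule ccontr)
      assume "\<not> ?thesis"
      then have "v r \<le> \<delta>" "v (Suc r) \<le> \<delta>" using r0[OF that] \<delta> by linarith+
      then show False using False by (simp add: u_def)
    qed
    have hi: "v r \<le> 3 * \<delta>"
    proof (rule ccontr)
      assume "\<not> ?thesis"
      then have "2 * \<delta> \<le> v r" "2 * \<delta> \<le> v (Suc r)" using r0[OF that] \<delta> by linarith+
      then show False using False by (simp add: u_def)
    qed
    have "\<bar>u (Suc r) - u r\<bar> \<le> \<bar>v (Suc r) - v r\<bar>" by (auto simp: u_def max_def min_def)
    also have "\<dots> \<le> C * \<beta> r * v r + \<epsilon> r * v r" using var[of r] by (simp add: algebra_simps)
    also have "C * \<beta> r * v r \<le> C * \<beta> r * (2 / \<delta> * (v r)\<^sup>2)"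
    proof (intro mult_left_mono)
      have "v r * (\<delta> / 2) \<le> v r * v r" using lo v[of r] by (intro mult_left_mono)
      then show "v r \<le> 2 / \<delta> * (v r)\<^sup>2" using \<delta> by (simp add: field_simps power2_eq_square)
    qed (use C \<beta> in auto)
    also have "\<epsilon> r * v r \<le> \<epsilon> r * (3 * \<delta>)" using hi \<epsilon> by (intro mult_left_mono)
    finally show ?thesis by (simp add: algebra_simps)
  qed
  \<comment> \<open>Absolutely summable increments make \<open>u\<close> converge by telescoping;
    its limit is then identified from the values it takes infinitely often.\<close>
  have "summable (\<lambda>r. u (Suc r) - u r)"
  proof (rule summable_comparison_test')
    show "summable (\<lambda>r. 2 * C / \<delta> * (\<beta> r * (v r)\<^sup>2) + 3 * \<delta> * \<epsilon> r)"
      by (intro summable_add summable_mult sq sum\<epsilon>)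
  qed (use bound in simp)
  then have "convergent (\<lambda>n. \<Sum>r<n. u (Suc r) - u r)" by (simp add: summable_iff_convergent)
  then have "convergent (\<lambda>n. u n - u 0)" by (simp add: sum_lessThan_telescope)
  then have "convergent (\<lambda>n. (u n - u 0) + u 0)" by (rule convergent_add[OF _ convergent_const])
  then obtain l where l: "u \<longlonglongrightarrow> l" by (auto simp: convergent_def)
  \<comment> \<open>If \<open>u\<close> eventually avoided its lower end, then eventually
    \<open>v r \<ge> \<delta>\<close>, and \<open>\<beta>\<close> would be dominated by a multiple
    of the summable series.\<close>
  have freq: "\<exists>\<^sub>F r in sequentially. u r = \<delta>"
  proof (rule ccontr)
    assume "\<not> ?thesis"
    then have "\<forall>\<^sub>F r in sequentially. u r \<noteq> \<delta>" by (simp add: frequently_def)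
    then have "\<forall>\<^sub>F r in sequentially. norm (\<beta> r) \<le> 1 / \<delta>\<^sup>2 * (\<beta> r * (v r)\<^sup>2)"
    proof eventually_elim
      fix r assume "u r \<noteq> \<delta>"
      then have "\<delta> \<le> v r" using \<delta> by (auto simp: u_def max_def min_def split: if_splits)
      then have "\<beta> r * \<delta>\<^sup>2 \<le> \<beta> r * (v r)\<^sup>2" using \<delta> \<beta> by (intro mult_left_mono power_mono) auto
      then show "norm (\<beta> r) \<le> 1 / \<delta>\<^sup>2 * (\<beta> r * (v r)\<^sup>2)" using \<delta> \<beta>[of r] by (simp add: field_simps)
    qed
    then have "summable \<beta>" by (rule summable_comparison_test_ev) (intro summable_mult sq)
    then show False using div by simp
  qed
  have "l = \<delta>"
  proof (rule ccontr)
    assume "l \<noteq> \<delta>"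
    then have "\<forall>\<^sub>F r in sequentially. u r \<noteq> \<delta>" using l by (rule tendsto_imp_eventually_ne[rotated])
    then show False using freq by (simp add: frequently_def)
  qed
  then have "\<forall>\<^sub>F r in sequentially. u r < 2 * \<delta>" using order_tendstoD(2)[OF l, of "2 * \<delta>"] \<delta> by simp
  then show "\<forall>\<^sub>F r in sequentially. v r < a"
    by eventually_elim (auto simp: u_def \<delta>_def max_def min_def split: if_splits)
qed

text \<open>As \<open>0 \<le> a r \<le> 1\<close>, the square of \<open>a r * b r\<close> is at most
  a term of the convergent series.\<close>

lemma tendsto_zero_of_summable_mult_square:
  fixes a b :: "nat \<Rightarrow> real"
  assumes "summable (\<lambda>r. a r * (b r)\<^sup>2)" and "\<And>r. 0 \<le> a r" "\<And>r. a r \<le> 1"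
  shows "(\<lambda>r. a r * b r) \<longlonglongrightarrow> 0"
proof -
  have "(\<lambda>r. a r * (b r)\<^sup>2) \<longlonglongrightarrow> 0" using assms(1) by (rule summable_LIMSEQ_zero)
  moreover have "(a r * b r)\<^sup>2 \<le> a r * (b r)\<^sup>2" for r
  proof -
    have "a r * (a r * (b r)\<^sup>2) \<le> 1 * (a r * (b r)\<^sup>2)"
      using assms(2,3)[of r] by (intro mult_right_mono) auto
    then show ?thesis by (simp add: power2_eq_square algebra_simps)
  qed
  ultimately have "(\<lambda>r. (a r * b r)\<^sup>2) \<longlonglongrightarrow> 0"
    by (rule_tac tendsto_sandwich[of "\<lambda>_. 0" _ _ "\<lambda>r. a r * (b r)\<^sup>2"]) (auto intro!: always_eventually)
  then have "(\<lambda>r. sqrt ((a r * b r)\<^sup>2)) \<longlonglongrightarrow> sqrt 0" by (rule tendsto_real_sqrt)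
  then show ?thesis by (simp add: tendsto_rabs_zero_iff)
qed

section \<open>Random series and simple random variables\<close>

text \<open>Sum and integral may be exchanged for nonnegative terms, so the integral of the series
  is at most \<open>B\<close>, and the series is finite almost everywhere.\<close>

lemma AE_summable_of_bounded_integrals:
  fixes Y :: "nat \<Rightarrow> 'w \<Rightarrow> real"
  assumes int: "\<And>n. integrable M (Y n)" and nonneg: "\<And>n w. Y n w \<ge> 0"
    and bound: "\<And>N. (\<Sum>n<N. integral\<^sup>L M (Y n)) \<le> B"
  shows "AE w in M. summable (\<lambda>n. Y n w)"
proof -
  have [measurable]: "Y n \<in> borel_measurable M" for n using int by (rule borel_measurable_integrable)
  have "(\<integral>\<^sup>+w. (\<Sum>n. ennreal (Y n w)) \<partial>M) = (\<Sum>n. \<integral>\<^sup>+w. ennreal (Y n w) \<partial>M)"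
    by (rule nn_integral_suminf) measurable
  also have "\<dots> = (\<Sum>n. ennreal (integral\<^sup>L M (Y n)))"
    by (simp add: nn_integral_eq_integral int nonneg)
  also have "\<dots> \<le> ennreal B"
    using bound by (intro suminf_le_const) (simp_all add: sum_ennreal integral_nonneg nonneg ennreal_leI)
  also have "\<dots> < \<infinity>" by simp
  finally have "(\<integral>\<^sup>+w. (\<Sum>n. ennreal (Y n w)) \<partial>M) \<noteq> \<infinity>" by simp
  then have "AE w in M. (\<Sum>n. ennreal (Y n w)) \<noteq> \<infinity>"
    by (intro nn_integral_noteq_infinite) auto
  then show ?thesis
    by eventually_elim (auto intro!: summable_suminf_not_top simp: nonneg)
qed

text \<open>The minimiser map is not shown to be measurable. Once an iterate has finite range, this
  lemma and composition make every function of it simple, hence measurable. Fibres are measurable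
  because points are closed.\<close>

lemma simple_function_finite_range:
  fixes Y :: "'w \<Rightarrow> 'a::t1_space"
  assumes "Y \<in> borel_measurable N" "finite (Y ` space N)"
  shows "simple_function N Y"
  using assms by (auto simp: simple_function_def intro!: measurable_sets)

lemma (in finite_measure) integrable_simple_function_finite:
  fixes \<phi> :: "'a \<Rightarrow> real"
  assumes "simple_function M \<phi>"
  shows "integrable M \<phi>"
proof -
  have "bounded (\<phi> ` space M)" using assms by (intro finite_imp_bounded simple_functionD(1))
  then obtain B where "\<And>w. w \<in> space M \<Longrightarrow> norm (\<phi> w) \<le> B" by (auto simp: bounded_iff)
  then show ?thesis
    using assms by (intro integrable_const_bound[of _ B] borel_measurable_simple_function) auto
qed

lemma history_subalgebra:
  assumes "\<And>r. x r \<in> borel_measurable M"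
  shows "subalgebra M (history M x r)"
proof -
  let ?G = "{x k -` B \<inter> space M | k B. k \<le> r \<and> B \<in> sets borel}"
  have G: "?G \<subseteq> sets M" using assms by (auto intro: measurable_sets)
  then have "?G \<subseteq> Pow (space M)" using sets.sets_into_space by blast
  then have "sets (history M x r) = sigma_sets (space M) ?G"
    unfolding history_def by (rule sets_measure_of)
  then show ?thesis
    using sets.sigma_sets_subset[OF G] by (simp add: subalgebra_def history_def space_measure_of_conv)
qed

lemma measurable_history: "x r \<in> borel_measurable (history M x r)"
  unfolding history_def by (rule measurableI) (auto simp: space_measure_of_conv)

section \<open>Convex functions\<close>

text \<open>A hyperplane separates the strict epigraph \<open>E\<close> of \<open>G - G z\<close>
  from the region \<open>H\<close> below the graph of \<open>- a \<bullet> (x - z)\<close> over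
  \<open>A\<close>; minimality of \<open>z\<close> makes them disjoint. The slope of the hyperplane,
  with its sign reversed, is the subgradient.\<close>

lemma subgradient_of_constrained_minimum:
  fixes G :: "'a::euclidean_space \<Rightarrow> real"
  assumes G: "convex_on UNIV G" and A: "convex A" "z \<in> A"
    and min: "\<And>x. x \<in> A \<Longrightarrow> a \<bullet> (x - z) + G x - G z \<ge> 0"
  obtains d where "d \<in> subdifferential G z" and "\<And>x. x \<in> A \<Longrightarrow> (a + d) \<bullet> (x - z) \<ge> 0"
proof -
  define E where "E = {p :: 'a \<times> real. G (fst p) - G z < snd p}"
  define H where "H = {p :: 'a \<times> real. fst p \<in> A \<and> snd p \<le> - (a \<bullet> (fst p - z))}"
  have "convex E"
  proof (rule convexI)
    fix p q and s t :: real
    assume pq: "p \<in> E" "q \<in> E" and st: "0 \<le> s" "0 \<le> t" "s + t = 1"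
    have "G (s *\<^sub>R fst p + t *\<^sub>R fst q) \<le> s * G (fst p) + t * G (fst q)"
      using G st unfolding convex_on_def by auto
    moreover have "s * (G (fst p) - G z) + t * (G (fst q) - G z) < s * snd p + t * snd q"
    proof (cases "s = 0")
      case False
      then have "s * (G (fst p) - G z) < s * snd p" using pq st by (simp add: E_def)
      moreover have "t * (G (fst q) - G z) \<le> t * snd q" using pq st by (auto simp: E_def intro: mult_left_mono)
      ultimately show ?thesis by simp
    qed (use pq st in \<open>simp add: E_def\<close>)
    moreover have "s * G z + t * G z = G z" using st by (metis distrib_right mult_1)
    ultimately show "s *\<^sub>R p + t *\<^sub>R q \<in> E" by (simp add: E_def algebra_simps)
  qed
  moreover have "convex H"
  proof (rule convexI)
    fix p q and s t :: real
    assume pq: "p \<in> H" "q \<in> H" and st: "0 \<le> s" "0 \<le> t" "s + t = 1"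
    have "s * snd p + t * snd q \<le> s * (- (a \<bullet> (fst p - z))) + t * (- (a \<bullet> (fst q - z)))"
      using pq st by (intro add_mono mult_left_mono) (auto simp: H_def)
    also have "\<dots> = - (a \<bullet> ((s *\<^sub>R fst p + t *\<^sub>R fst q) - (s + t) *\<^sub>R z))"
      by (simp add: algebra_simps)
    finally show "s *\<^sub>R p + t *\<^sub>R q \<in> H"
      using pq st A(1) by (auto simp: H_def convex_def)
  qed
  moreover have "(z, 1) \<in> E" by (simp add: E_def)
  moreover have "(z, 0) \<in> H" using A by (simp add: H_def)
  moreover have "H \<inter> E = {}" using min by (force simp: E_def H_def)
  ultimately obtain c b where c: "c \<noteq> 0" and cH: "\<forall>p\<in>H. c \<bullet> p \<le> b" and cE: "\<forall>p\<in>E. c \<bullet> p \<ge> b"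
    using separating_hyperplane_sets[of H E] by blast
  obtain p q where pq: "c = (p, q)" by (cases c)
  have H: "p \<bullet> x + q * t \<le> b" if "x \<in> A" "t \<le> - (a \<bullet> (x - z))" for x t
    using cH that by (auto simp: H_def pq dest!: bspec[where x="(x,t)"])
  have E: "p \<bullet> x + q * t \<ge> b" if "G x - G z < t" for x t
    using cE that by (auto simp: E_def pq dest!: bspec[where x="(x,t)"])
  have z: "p \<bullet> z \<le> b" using H[of z 0] A by simp
  have "q \<ge> 0" using H[of z "-1"] E[of z 1] A(2) by simp
  \<comment> \<open>A vertical hyperplane is impossible because \<open>G\<close> is finite on the
    whole space: \<open>E\<close> contains points above \<open>z - p\<close>, which lies strictly on
    the wrong side unless \<open>p = 0\<close>.\<close>
  moreover have "q \<noteq> 0"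
  proof
    assume q: "q = 0"
    have "p \<bullet> (z - p) \<ge> p \<bullet> z" using E[of "z - p" "G (z - p) - G z + 1"] z q by simp
    then have "p \<bullet> p = 0" using inner_ge_zero[of p] by (simp add: inner_diff_right)
    then have "p = 0" by simp
    then show False using c q pq by (simp add: zero_prod_def)
  qed
  ultimately have q: "q > 0" by simp
  \<comment> \<open>The inequality passes from the strict epigraph to the graph of
    \<open>G - G z\<close> by letting the excess height tend to 0.\<close>
  have E': "p \<bullet> x + q * (G x - G z) \<ge> b" for x
  proof (rule field_le_epsilon)
    fix e :: real assume "e > 0"
    then show "b \<le> p \<bullet> x + q * (G x - G z) + e"
      using E[of x "G x - G z + e / q"] q by (simp add: algebra_simps)
  qed
  have bz: "b = p \<bullet> z" using z E'[of z] by simp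
  show ?thesis
  proof (rule that[of "- (1 / q) *\<^sub>R p"])
    show "- (1 / q) *\<^sub>R p \<in> subdifferential G z"
    proof (unfold subdifferential_def, intro CollectI allI)
      fix y
      have "q * (G z - G y) \<le> p \<bullet> (y - z)"
        using E'[of y] bz by (simp add: algebra_simps)
      then have "G z - G y \<le> (p \<bullet> (y - z)) / q" using q by (simp add: field_simps)
      then show "G z + - (1 / q) *\<^sub>R p \<bullet> (y - z) \<le> G y" by simp
    qed
    fix x assume "x \<in> A"
    then have "q * (- (a \<bullet> (x - z))) \<le> - (p \<bullet> (x - z))"
      using H[of x "- (a \<bullet> (x - z))"] bz by (simp add: inner_diff_right)
    then have "0 \<le> q * ((a + - (1 / q) *\<^sub>R p) \<bullet> (x - z))"
      using q by (simp add: inner_add_left algebra_simps)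
    then show "0 \<le> (a + - (1 / q) *\<^sub>R p) \<bullet> (x - z)" using q by (simp add: zero_le_mult_iff)
  qed
qed

text \<open>The mean value theorem on the segment from \<open>x\<close> to \<open>y\<close> gives
  the constant \<open>L\<close> in place of the sharper \<open>L / 2\<close>; this matches the
  step-size bound \<open>\<tau> / L\<close>.\<close>

lemma C1_lipschitz_gradient_upper_bound:
  assumes f: "C1_on_with_gradient A f G" and G: "L-lipschitz_on A G" and A: "convex A" "x \<in> A" "y \<in> A"
  shows "f y \<le> f x + G x \<bullet> (y - x) + L * (norm (y - x))\<^sup>2"
proof -
  define l where "l t = x + t *\<^sub>R (y - x)" for t :: real
  have lA: "l t \<in> A" if "t \<in> {0..1}" for t
  proof -
    have "(1 - t) *\<^sub>R x + t *\<^sub>R y \<in> A" using that A by (auto simp: convex_def)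
    then show ?thesis by (simp add: l_def algebra_simps)
  qed
  \<comment> \<open>Derivatives are taken within \<open>A\<close> and within the unit interval,
    since \<open>A\<close> may have empty interior.\<close>
  have der: "((\<lambda>t. f (l t)) has_derivative (\<lambda>h. G (l t) \<bullet> (h *\<^sub>R (y - x)))) (at t within {0..1})"
    if "0 \<le> t" "t \<le> 1" for t
  proof (rule has_derivative_in_compose[where f=l and g=f and f'="\<lambda>h. h *\<^sub>R (y - x)"])
    show "(l has_derivative (\<lambda>h. h *\<^sub>R (y - x))) (at t within {0..1})"
      unfolding l_def by (auto intro!: derivative_eq_intros)
    show "(f has_derivative (\<lambda>v. G (l t) \<bullet> v)) (at (l t) within l ` {0..1})"
      by (rule has_derivative_subset[where s=A])
        (use f lA that in \<open>auto simp: C1_on_with_gradient_def\<close>)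
  qed
  obtain t where t: "t \<in> {0<..<1}" and "f (l 1) - f (l 0) = G (l t) \<bullet> ((1 - 0) *\<^sub>R (y - x))"
    using mvt_simple[OF zero_less_one der] by blast
  then have eq: "f y - f x = G (l t) \<bullet> (y - x)" by (simp add: l_def)
  have L: "L \<ge> 0" using G by (rule lipschitz_on_nonneg)
  have "dist (G (l t)) (G x) \<le> L * dist (l t) x"
    using lA[of t] t A by (intro lipschitz_onD[OF G]) auto
  also have "\<dots> \<le> L * norm (y - x)"
    using t L by (intro mult_left_mono) (auto simp: l_def dist_norm mult_left_le_one_le)
  finally have "norm (G (l t) - G x) \<le> L * norm (y - x)" by (simp add: dist_norm)
  then have "norm (G (l t) - G x) * norm (y - x) \<le> L * norm (y - x) * norm (y - x)"
    by (intro mult_right_mono) auto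
  then have "(G (l t) - G x) \<bullet> (y - x) \<le> L * (norm (y - x))\<^sup>2"
    using norm_cauchy_schwarz[of "G (l t) - G x" "y - x"] by (simp add: power2_eq_square mult.assoc)
  then show ?thesis using eq by (simp add: inner_diff_left)
qed

section \<open>Block coordinates\<close>

text \<open>For the selected set \<open>S\<close> and the displacement \<open>v\<close>, this is the
  direction of one update.\<close>

definition blocks :: "('k::finite \<Rightarrow> 'n::finite) \<Rightarrow> 'n set \<Rightarrow> real ^ 'k \<Rightarrow> real ^ 'k" where
  "blocks blk S v = (\<Sum>i\<in>S. block blk i v)"

lemma linear_block: "linear (block blk i)"
  by (rule linearI) (auto simp: block_def vec_eq_iff)

lemmas block_simps = linear_0[OF linear_block] linear_add[OF linear_block]
  linear_diff[OF linear_block] linear_cmul[OF linear_block]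

lemma block_in_block_space: "block blk i x \<in> block_space blk i"
  by (simp add: block_def block_space_def)

lemma block_eq_self: "v \<in> block_space blk i \<Longrightarrow> block blk i v = v"
  by (auto simp: block_def block_space_def vec_eq_iff)

lemma block_block: "block blk i (block blk j x) = (if i = j then block blk i x else 0)"
  by (simp add: block_def vec_eq_iff)

lemma block_blocks: "block blk i (blocks blk S x) = (if i \<in> S then block blk i x else 0)"
  by (simp add: blocks_def linear_sum[OF linear_block] block_block)

lemma blocks_UNIV: "blocks blk UNIV x = x"
  by (simp add: blocks_def block_def vec_eq_iff)

lemma block_eqI: "(\<And>i. block blk i x = block blk i y) \<Longrightarrow> x = y"
  using blocks_UNIV[of blk x] blocks_UNIV[of blk y] by (simp add: blocks_def)

lemma linear_blocks: "linear (blocks blk S)"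
  by (rule linearI) (auto simp: blocks_def block_simps sum.distrib scaleR_sum_right)

lemma inner_block: "x \<bullet> block blk i y = block blk i x \<bullet> block blk i y"
  unfolding inner_vec_def by (rule sum.cong) (simp_all add: block_def)

lemma inner_blocks: "x \<bullet> blocks blk S y = (\<Sum>i\<in>S. block blk i x \<bullet> block blk i y)"
  by (simp add: blocks_def inner_sum_right flip: inner_block)

lemma norm_blocks_sq: "(norm (blocks blk S x))\<^sup>2 = (\<Sum>i\<in>S. (norm (block blk i x))\<^sup>2)"
  by (simp add: power2_norm_eq_inner inner_blocks block_blocks cong: sum.cong)

lemma norm_sq_eq_sum_blocks: "(norm x)\<^sup>2 = (\<Sum>i\<in>UNIV. (norm (block blk i x))\<^sup>2)"
  by (metis norm_blocks_sq blocks_UNIV)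

lemma norm_block_le_blocks: "i \<in> S \<Longrightarrow> norm (block blk i x) \<le> norm (blocks blk S x)"
  by (rule power2_le_imp_le)
    (use member_le_sum[of i S "\<lambda>i. (norm (block blk i x))\<^sup>2"] in \<open>simp_all add: norm_blocks_sq\<close>)

lemma norm_blocks_le: "norm (blocks blk S x) \<le> norm x"
  by (rule power2_le_imp_le) (auto simp: norm_blocks_sq norm_sq_eq_sum_blocks[of x blk] intro!: sum_mono2)

lemma norm_block_le: "norm (block blk i x) \<le> norm x"
  using norm_block_le_blocks[of i UNIV blk x] by (simp add: blocks_UNIV)

lemma norm_le_sum_blocks: "norm x \<le> (\<Sum>i\<in>UNIV. norm (block blk i x))"
  by (metis blocks_UNIV blocks_def norm_sum)

text \<open>Composition with the projection extends \<open>\<phi>\<close> to a finite convex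
  function on the whole space, so that continuity and separation arguments apply without any
  boundary.\<close>

lemma convex_on_comp_block:
  assumes "convex_on (block_space blk i) \<phi>"
  shows "convex_on UNIV (\<lambda>x. \<phi> (block blk i x))"
  using assms by (auto simp: convex_on_def block_simps block_in_block_space)

lemma continuous_block: "continuous_on A (block blk i)"
  by (simp add: linear_continuous_on linear_conv_bounded_linear[symmetric] linear_block)

lemma convex_feasible: "(\<And>i. convex (X i)) \<Longrightarrow> convex (feasible blk X)"
  by (auto simp: convex_def feasible_def block_simps)

lemma closed_feasible:
  assumes "\<And>i. closed (X i)"
  shows "closed (feasible blk X)"
proof -
  have "feasible blk X = (\<Inter>i. block blk i -` X i)" by (auto simp: feasible_def)
  then show ?thesis using assms by (auto intro!: closed_INT closed_vimage continuous_block)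
qed

lemma convex_separable_sum:
  fixes blk :: "'c::finite \<Rightarrow> 'n::finite"
  assumes "\<And>i. convex_on (block_space blk i) (g i)"
  shows "convex_on UNIV (separable_sum blk g)"
  unfolding convex_on_def
proof (intro conjI ballI allI impI)
  fix x y :: "real ^ 'c" and s t :: real
  assume st: "0 \<le> s" "0 \<le> t" "s + t = 1"
  have "separable_sum blk g (s *\<^sub>R x + t *\<^sub>R y)
      \<le> (\<Sum>i\<in>UNIV. s * g i (block blk i x) + t * g i (block blk i y))"
    unfolding separable_sum_def
    using convex_on_comp_block[OF assms] st by (intro sum_mono) (auto simp: convex_on_def)
  then show "separable_sum blk g (s *\<^sub>R x + t *\<^sub>R y) \<le> s * separable_sum blk g x + t * separable_sum blk g y"
    by (simp add: separable_sum_def sum.distrib sum_distrib_left)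
qed simp

section \<open>One step of the algorithm\<close>

locale psca =
  fixes blk :: "'k::finite \<Rightarrow> 'n::finite"
    and X :: "'n \<Rightarrow> (real ^ 'k) set"
    and f :: "real ^ 'k \<Rightarrow> real" and gradf :: "real ^ 'k \<Rightarrow> real ^ 'k"
    and g :: "'n \<Rightarrow> real ^ 'k \<Rightarrow> real"
    and ft :: "'n \<Rightarrow> real ^ 'k \<Rightarrow> real ^ 'k \<Rightarrow> real"
    and gradft :: "'n \<Rightarrow> real ^ 'k \<Rightarrow> real ^ 'k \<Rightarrow> real ^ 'k"
    and L Lt \<tau> :: real
  assumes X_sub: "\<And>i. X i \<subseteq> block_space blk i"
    and X_closed: "\<And>i. closed (X i)" and X_convex: "\<And>i. convex (X i)"
    and f: "C1_on_with_gradient (feasible blk X) f gradf"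
    and f_lip: "L-lipschitz_on (feasible blk X) gradf"
    and g: "\<And>i. convex_on (block_space blk i) (g i)"
    and h_bdd: "bdd_below ((\<lambda>x. f x + separable_sum blk g x) ` feasible blk X)"
    and ft: "\<And>i y. y \<in> feasible blk X \<Longrightarrow> C1_on_with_gradient (X i) (\<lambda>u. ft i u y) (\<lambda>u. gradft i u y)"
    and tau: "\<tau> > 0"
    and strong: "\<And>i u v y. u \<in> X i \<Longrightarrow> v \<in> X i \<Longrightarrow> y \<in> feasible blk X \<Longrightarrow>
        ft i u y \<ge> ft i v y + gradft i v y \<bullet> (u - v) + \<tau> / 2 * (norm (u - v))\<^sup>2"
    and consistent: "\<And>i x. x \<in> feasible blk X \<Longrightarrow> gradft i (block blk i x) x = block blk i (gradf x)"
    and ft_lip: "\<And>i u. u \<in> X i \<Longrightarrow> Lt-lipschitz_on (feasible blk X) (\<lambda>y. gradft i u y)"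
begin

abbreviation F where "F \<equiv> feasible blk X"
abbreviation bl where "bl \<equiv> block blk"
abbreviation G where "G \<equiv> separable_sum blk g"
definition h where "h x = f x + G x"

text \<open>A single vector \<open>w\<close> carries the minimisers of all blocks, which lie in
  complementary coordinate subspaces.\<close>

definition responds :: "real ^ 'k \<Rightarrow> real ^ 'k \<Rightarrow> bool" where
  "responds y w \<longleftrightarrow> (\<forall>i. is_arg_min (\<lambda>u. ft i u y + g i u) (\<lambda>u. u \<in> X i) (bl i w))"

text \<open>At a feasible point with a response, strong convexity makes the response unique, so the
  choice is immaterial there; see \<open>disp_eqI\<close>.\<close>

definition disp :: "real ^ 'k \<Rightarrow> real ^ 'k" where
  "disp y = (SOME w. responds y w) - y"

text \<open>Outside \<open>Dom\<close> the displacement \<open>disp\<close> is a junk value.\<close>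

definition Dom :: "(real ^ 'k) set" where
  "Dom = {y \<in> F. \<exists>w. responds y w}"

section \<open>Block minimisers and their dependence on the base point\<close>

lemma block_mem: "y \<in> F \<Longrightarrow> bl i y \<in> X i"
  by (simp add: feasible_def)

lemma Lt_nonneg: "y \<in> F \<Longrightarrow> Lt \<ge> 0"
  using ft_lip block_mem lipschitz_on_nonneg by blast

lemma L_nonneg: "L \<ge> 0"
  using f_lip by (rule lipschitz_on_nonneg)

text \<open>Sum of the strong convexity inequality and the one with \<open>u\<close> and
  \<open>v\<close> exchanged, hence \<open>\<tau>\<close> and not \<open>\<tau> / 2\<close>.\<close>

lemma strongly_monotone:
  assumes "u \<in> X i" "v \<in> X i" "y \<in> F"
  shows "\<tau> * (norm (u - v))\<^sup>2 \<le> (gradft i u y - gradft i v y) \<bullet> (u - v)"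
  using strong[OF assms] strong[OF assms(2,1,3)]
  by (simp add: inner_diff_left inner_diff_right norm_minus_commute)

text \<open>The minimiser \<open>a\<close> is compared with the points \<open>v n\<close> on the
  segment towards \<open>u\<close>; dividing by \<open>t n\<close> and letting it tend to 0 gives
  the inequality.\<close>

lemma responds_variational:
  assumes y: "y \<in> F" and w: "responds y w" and u: "u \<in> X i"
  shows "gradft i (bl i w) y \<bullet> (u - bl i w) + g i u - g i (bl i w) \<ge> 0"
proof -
  define a where "a = bl i w"
  have a: "a \<in> X i" and min: "\<And>v. v \<in> X i \<Longrightarrow> ft i a y + g i a \<le> ft i v y + g i v"
    using w by (auto simp: responds_def is_arg_min_def a_def not_less)
  define t where "t n = 1 / real (Suc n)" for n
  have t: "t \<longlonglongrightarrow> 0" unfolding t_def by (rule LIMSEQ_Suc[OF lim_1_over_n])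
  have t01: "0 < t n" "t n \<le> 1" for n by (auto simp: t_def)
  define v where "v n = a + t n *\<^sub>R (u - a)" for n
  have v: "v n = (1 - t n) *\<^sub>R a + t n *\<^sub>R u" for n by (simp add: v_def algebra_simps)
  have vX: "v n \<in> X i" for n
    using X_convex[of i] a u t01[of n] unfolding v convex_def by (auto simp: less_imp_le)
  have "v \<longlonglongrightarrow> a + 0 *\<^sub>R (u - a)" unfolding v_def by (intro tendsto_intros t)
  moreover have "continuous_on (X i) (\<lambda>u. gradft i u y)"
    using ft[OF y] by (simp add: C1_on_with_gradient_def)
  ultimately have "(\<lambda>n. gradft i (v n) y) \<longlonglongrightarrow> gradft i a y"
    using a vX by (intro continuous_on_tendsto_compose[where f="\<lambda>u. gradft i u y"]) auto
  then have "(\<lambda>n. gradft i (v n) y \<bullet> (u - a) + g i u - g i a) \<longlonglongrightarrow> gradft i a y \<bullet> (u - a) + g i u - g i a"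
    by (intro tendsto_intros)
  moreover have "gradft i (v n) y \<bullet> (u - a) + g i u - g i a \<ge> 0" for n
  proof -
    have "g i (v n) \<le> (1 - t n) * g i a + t n * g i u"
      using g[of i] a u X_sub[of i] t01[of n] unfolding v convex_on_def by (auto simp: less_imp_le subset_iff)
    \<comment> \<open>Convexity at \<open>v n\<close> bounds the increment by the gradient at
      \<open>v n\<close>; continuity of the gradient later replaces \<open>v n\<close> by
      \<open>a\<close>.\<close>
    moreover have "ft i (v n) y - ft i a y \<le> gradft i (v n) y \<bullet> (v n - a)"
    proof -
      have "0 \<le> \<tau> / 2 * (norm (a - v n))\<^sup>2" using tau by simp
      then show ?thesis using strong[OF a vX y, of n] by (simp add: inner_diff_right)
    qed
    moreover have "gradft i (v n) y \<bullet> (v n - a) = t n * (gradft i (v n) y \<bullet> (u - a))" by (simp add: v_def)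
    ultimately have "0 \<le> t n * (gradft i (v n) y \<bullet> (u - a) + g i u - g i a)"
      using min[OF vX, of n] by (simp add: algebra_simps)
    then show ?thesis using t01[of n] by (simp add: zero_le_mult_iff)
  qed
  ultimately show ?thesis unfolding a_def[symmetric] by (intro LIMSEQ_le_const) auto
qed

lemma responds_block_mem: "responds y w \<Longrightarrow> bl i w \<in> X i"
  by (simp add: responds_def is_arg_min_def)

text \<open>Each variational inequality is tested with the other minimiser. In the sum the values of
  \<open>g i\<close> cancel, leaving strong monotonicity against the Lipschitz bound in the base
  point.\<close>

lemma responds_lipschitz:
  assumes y: "y \<in> F" "responds y w" and z: "z \<in> F" "responds z v"
  shows "norm (bl i (w - v)) \<le> Lt / \<tau> * norm (y - z)"
proof -
  define a b where "a = bl i w" and "b = bl i v"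
  have ab: "a \<in> X i" "b \<in> X i" using y z responds_block_mem by (auto simp: a_def b_def)
  have "\<tau> * (norm (a - b))\<^sup>2 \<le> (gradft i a y - gradft i b y) \<bullet> (a - b)"
    by (rule strongly_monotone[OF ab y(1)])
  also have "\<dots> \<le> (gradft i b z - gradft i b y) \<bullet> (a - b)"
    using responds_variational[OF y ab(2)] responds_variational[OF z ab(1)]
    unfolding a_def[symmetric] b_def[symmetric] by (simp add: inner_diff_left inner_diff_right)
  also have "\<dots> \<le> norm (gradft i b z - gradft i b y) * norm (a - b)" by (rule norm_cauchy_schwarz)
  also have "\<dots> \<le> Lt * norm (y - z) * norm (a - b)"
    using lipschitz_onD[OF ft_lip[OF ab(2)] z(1) y(1)]
    by (intro mult_right_mono) (auto simp: dist_norm norm_minus_commute)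
  finally have *: "\<tau> * (norm (a - b))\<^sup>2 \<le> Lt * norm (y - z) * norm (a - b)" .
  have "norm (a - b) \<le> Lt / \<tau> * norm (y - z)"
  proof (cases "a = b")
    case True
    then show ?thesis using Lt_nonneg[OF y(1)] tau by simp
  next
    case False
    then have "\<tau> * norm (a - b) \<le> Lt * norm (y - z)" using * by (simp add: power2_eq_square)
    then show ?thesis using tau by (simp add: field_simps)
  qed
  then show ?thesis by (simp add: a_def b_def block_simps)
qed

lemma responds_disp:
  assumes "y \<in> Dom"
  shows "responds y (y + disp y)"
proof -
  obtain w where "responds y w" using assms by (auto simp: Dom_def)
  then have "responds y (SOME w. responds y w)" by (rule someI)
  then show ?thesis by (simp add: disp_def)
qed

text \<open>Uniqueness of the response is \<open>responds_lipschitz\<close> with equal base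
  points.\<close>

lemma disp_eqI:
  assumes "y \<in> F" "responds y w"
  shows "disp y = w - y"
proof -
  have "responds y (y + disp y)" using assms by (intro responds_disp) (auto simp: Dom_def)
  from responds_lipschitz[OF assms(1) this assms] have "bl i (y + disp y) = bl i w" for i
    by (simp add: block_simps)
  then have "y + disp y = w" by (rule block_eqI)
  then show ?thesis by (simp add: algebra_simps)
qed

text \<open>A Lipschitz constant of \<open>disp\<close> on \<open>Dom\<close>: each of the block
  minimisers contributes \<open>Lt / \<tau>\<close>, and subtracting the base point contributes
  1.\<close>

definition C where "C = 1 + real CARD('n) * (Lt / \<tau>)"

lemma C_nonneg: "y \<in> F \<Longrightarrow> C \<ge> 0"
  using Lt_nonneg tau by (simp add: C_def)

lemma disp_lipschitz:
  assumes "y \<in> Dom" "z \<in> Dom"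
  shows "norm (disp y - disp z) \<le> C * norm (y - z)"
proof -
  have F: "y \<in> F" "z \<in> F" using assms by (auto simp: Dom_def)
  define w where "w = y + disp y - (z + disp z)"
  have "norm w \<le> (\<Sum>i\<in>(UNIV :: 'n set). norm (bl i w))" by (rule norm_le_sum_blocks)
  also have "\<dots> \<le> (\<Sum>i\<in>(UNIV :: 'n set). Lt / \<tau> * norm (y - z))"
    unfolding w_def by (intro sum_mono responds_lipschitz responds_disp assms F)
  finally have "norm w \<le> real CARD('n) * (Lt / \<tau>) * norm (y - z)" by simp
  moreover have "norm (disp y - disp z) \<le> norm w + norm (y - z)"
    using norm_triangle_ineq4[of w "y - z"] by (simp add: w_def algebra_simps)
  ultimately show ?thesis by (simp add: C_def algebra_simps)
qed

text \<open>The variational inequality at the minimiser is tested with the current block. Strong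
  monotonicity moves the gradient back to the current point, where consistency turns it into a block
  of \<open>gradf\<close>.\<close>

lemma block_descent:
  assumes "y \<in> Dom"
  shows "bl i (gradf y) \<bullet> bl i (disp y) + g i (bl i (y + disp y)) - g i (bl i y)
    \<le> - \<tau> * (norm (bl i (disp y)))\<^sup>2"
proof -
  have y: "y \<in> F" using assms by (simp add: Dom_def)
  define w where "w = y + disp y"
  have w: "responds y w" unfolding w_def by (rule responds_disp[OF assms])
  have d: "bl i (disp y) = bl i w - bl i y" by (simp add: w_def block_simps)
  have "gradft i (bl i w) y \<bullet> (bl i y - bl i w) + g i (bl i y) - g i (bl i w) \<ge> 0"
    by (rule responds_variational[OF y w block_mem[OF y]])
  moreover have "\<tau> * (norm (bl i w - bl i y))\<^sup>2 \<le>
      (gradft i (bl i w) y - gradft i (bl i y) y) \<bullet> (bl i w - bl i y)"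
    by (intro strongly_monotone responds_block_mem[OF w] block_mem y)
  ultimately show ?thesis
    unfolding d w_def[symmetric] consistent[OF y] by (simp add: inner_diff_left inner_diff_right)
qed

lemma block_step_mem:
  assumes "y \<in> Dom" "0 \<le> t" "t \<le> 1"
  shows "bl i (y + t *\<^sub>R disp y) \<in> X i"
proof -
  have "(1 - t) *\<^sub>R bl i y + t *\<^sub>R bl i (y + disp y) \<in> X i"
    using X_convex[of i] assms block_mem[of y] responds_block_mem[OF responds_disp]
    by (auto simp: convex_def Dom_def)
  then show ?thesis by (simp add: block_simps algebra_simps)
qed

lemma step_mem:
  assumes "y \<in> Dom" "0 \<le> t" "t \<le> 1"
  shows "y + t *\<^sub>R blocks blk S (disp y) \<in> F"
  using block_step_mem[OF assms] assms(1)
  by (auto simp: feasible_def Dom_def block_simps block_blocks)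

text \<open>The quadratic upper bound controls \<open>f\<close>. Each selected block moves to a
  convex combination of itself and its minimiser, so convexity controls \<open>g i\<close>; summing
  \<open>block_descent\<close> over \<open>S\<close> gives the linear gain \<open>\<tau>\<close>
  against the quadratic loss \<open>L * t\<close>.\<close>

lemma step_descent:
  assumes y: "y \<in> Dom" and t: "0 \<le> t" "t \<le> 1"
  shows "h (y + t *\<^sub>R blocks blk S (disp y)) \<le> h y - t * (\<tau> - L * t) * (norm (blocks blk S (disp y)))\<^sup>2"
proof -
  define D where "D = blocks blk S (disp y)"
  define y' where "y' = y + t *\<^sub>R D"
  have yF: "y \<in> F" using y by (simp add: Dom_def)
  have y'F: "y' \<in> F" unfolding y'_def D_def by (rule step_mem[OF y t])
  have "f y' \<le> f y + gradf y \<bullet> (y' - y) + L * (norm (y' - y))\<^sup>2"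
    using f f_lip convex_feasible[OF X_convex] yF y'F by (rule C1_lipschitz_gradient_upper_bound)
  then have f: "f y' \<le> f y + t * (gradf y \<bullet> D) + L * t * t * (norm D)\<^sup>2"
    using t by (simp add: y'_def power_mult_distrib power2_eq_square ac_simps)
  have "g i (bl i y') \<le> g i (bl i y) + (if i \<in> S then t * (g i (bl i (y + disp y)) - g i (bl i y)) else 0)" for i
  proof (cases "i \<in> S")
    case True
    have "bl i y' = (1 - t) *\<^sub>R bl i y + t *\<^sub>R bl i (y + disp y)"
      using True by (simp add: y'_def D_def block_simps block_blocks algebra_simps)
    also have "g i \<dots> \<le> (1 - t) * g i (bl i y) + t * g i (bl i (y + disp y))"
      using g[of i] t unfolding convex_on_def by (auto simp: block_in_block_space)
    finally show ?thesis using True by (simp add: algebra_simps)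
  next
    case False
    then show ?thesis by (simp add: y'_def D_def block_simps block_blocks)
  qed
  then have "G y' \<le> (\<Sum>i\<in>UNIV. g i (bl i y) + (if i \<in> S then t * (g i (bl i (y + disp y)) - g i (bl i y)) else 0))"
    unfolding separable_sum_def by (rule sum_mono)
  also have "\<dots> = G y + t * (\<Sum>i\<in>S. g i (bl i (y + disp y)) - g i (bl i y))"
    by (simp add: separable_sum_def sum.distrib sum.If_cases sum_distrib_left)
  finally have "h y' \<le> h y + t * (gradf y \<bullet> D + (\<Sum>i\<in>S. g i (bl i (y + disp y)) - g i (bl i y)))
      + L * t * t * (norm D)\<^sup>2"
    using f by (simp add: h_def algebra_simps)
  moreover have "gradf y \<bullet> D + (\<Sum>i\<in>S. g i (bl i (y + disp y)) - g i (bl i y)) \<le> - \<tau> * (norm D)\<^sup>2"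
  proof -
    have "gradf y \<bullet> D + (\<Sum>i\<in>S. g i (bl i (y + disp y)) - g i (bl i y))
        = (\<Sum>i\<in>S. bl i (gradf y) \<bullet> bl i (disp y) + g i (bl i (y + disp y)) - g i (bl i y))"
      by (simp add: D_def inner_blocks sum.distrib sum_subtractf)
    also have "\<dots> \<le> (\<Sum>i\<in>S. - \<tau> * (norm (bl i (disp y)))\<^sup>2)" by (intro sum_mono block_descent y)
    finally show ?thesis by (simp add: D_def norm_blocks_sq sum_distrib_left)
  qed
  then have "t * (gradf y \<bullet> D + (\<Sum>i\<in>S. g i (bl i (y + disp y)) - g i (bl i y))) \<le> t * (- \<tau> * (norm D)\<^sup>2)"
    using t(1) by (rule mult_left_mono)
  ultimately show ?thesis unfolding y'_def D_def by (simp add: algebra_simps)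
qed

lemma h_lower_bound: obtains b where "\<And>x. x \<in> F \<Longrightarrow> b \<le> h x"
  using h_bdd by (auto simp: bdd_below_def h_def)

text \<open>Vanishing displacements send the minimisers to \<open>z\<close> as well, so the block
  variational inequalities pass to the limit, where consistency replaces the surrogate gradients by
  \<open>gradf z\<close>.\<close>

lemma stationary_limit:
  assumes x: "\<And>r. x r \<in> Dom" and d: "(\<lambda>r. disp (x r)) \<longlonglongrightarrow> 0" and z: "x \<longlonglongrightarrow> z"
  shows "stationary F gradf G z"
proof -
  have xF: "x r \<in> F" for r using x by (simp add: Dom_def)
  have zF: "z \<in> F"
    using closed_feasible[OF X_closed] xF z by (rule closed_sequentially)
  define w where "w r = x r + disp (x r)" for r
  have w: "responds (x r) (w r)" for r unfolding w_def by (rule responds_disp[OF x])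
  have "w \<longlonglongrightarrow> z" using tendsto_add[OF z d] by (simp add: w_def[abs_def])
  then have bw: "(\<lambda>r. bl i (w r)) \<longlonglongrightarrow> bl i z" for i
    by (rule continuous_on_tendsto_compose[OF continuous_block[of UNIV]]) auto
  have var: "bl i (gradf z) \<bullet> (u - bl i z) + g i u - g i (bl i z) \<ge> 0" if u: "u \<in> X i" for i u
  proof -
    have "(\<lambda>r. gradft i (bl i (w r)) z) \<longlonglongrightarrow> gradft i (bl i z) z"
      using ft[OF zF, of i] block_mem[OF zF] responds_block_mem[OF w] bw
      by (intro continuous_on_tendsto_compose[where f="\<lambda>u. gradft i u z"]) (auto simp: C1_on_with_gradient_def)
    \<comment> \<open>Continuity in the first argument is available for a fixed base point only; the
      Lipschitz bound, uniform in the first argument, moves the base point from \<open>x r\<close>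
      to \<open>z\<close>.\<close>
    moreover have "(\<lambda>r. gradft i (bl i (w r)) (x r) - gradft i (bl i (w r)) z) \<longlonglongrightarrow> 0"
    proof (rule Lim_null_comparison)
      show "\<forall>\<^sub>F r in sequentially. norm (gradft i (bl i (w r)) (x r) - gradft i (bl i (w r)) z)
          \<le> Lt * norm (x r - z)"
        using lipschitz_onD[OF ft_lip[OF responds_block_mem[OF w]] xF zF]
        by (intro always_eventually allI) (simp add: dist_norm)
      have "(\<lambda>r. Lt * norm (x r - z)) \<longlonglongrightarrow> Lt * norm (z - z)" by (intro tendsto_intros z)
      then show "(\<lambda>r. Lt * norm (x r - z)) \<longlonglongrightarrow> 0" by simp
    qed
    ultimately have "(\<lambda>r. gradft i (bl i (w r)) z + (gradft i (bl i (w r)) (x r) - gradft i (bl i (w r)) z))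
        \<longlonglongrightarrow> gradft i (bl i z) z + 0"
      by (rule tendsto_add)
    then have grad: "(\<lambda>r. gradft i (bl i (w r)) (x r)) \<longlonglongrightarrow> bl i (gradf z)"
      by (simp add: consistent[OF zF])
    have "continuous_on UNIV (\<lambda>x. g i (bl i x))"
      by (intro convex_on_continuous convex_on_comp_block g) auto
    then have "(\<lambda>r. g i (bl i (w r))) \<longlonglongrightarrow> g i (bl i z)"
      by (rule continuous_on_tendsto_compose[OF _ \<open>w \<longlonglongrightarrow> z\<close>]) auto
    then have "(\<lambda>r. gradft i (bl i (w r)) (x r) \<bullet> (u - bl i (w r)) + g i u - g i (bl i (w r)))
        \<longlonglongrightarrow> bl i (gradf z) \<bullet> (u - bl i z) + g i u - g i (bl i z)"
      by (intro tendsto_intros grad bw)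
    then show ?thesis
      using responds_variational[OF xF w u] by (intro LIMSEQ_le_const) auto
  qed
  \<comment> \<open>Summed over the blocks, the limit inequalities say that \<open>z\<close>
    minimises the problem with \<open>f\<close> linearised at \<open>z\<close>.\<close>
  have "gradf z \<bullet> (y - z) + G y - G z \<ge> 0" if y: "y \<in> F" for y
  proof -
    have "gradf z \<bullet> (y - z) = (\<Sum>i\<in>UNIV. bl i (gradf z) \<bullet> (bl i y - bl i z))"
      using inner_blocks[of "gradf z" blk UNIV "y - z"] by (simp add: blocks_UNIV block_simps)
    then have "gradf z \<bullet> (y - z) + G y - G z
        = (\<Sum>i\<in>UNIV. bl i (gradf z) \<bullet> (bl i y - bl i z) + g i (bl i y) - g i (bl i z))"
      by (simp add: separable_sum_def sum.distrib sum_subtractf)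
    then show ?thesis using var[OF block_mem[OF y]] by (simp add: sum_nonneg)
  qed
  then obtain d where "d \<in> subdifferential G z" "\<And>x. x \<in> F \<Longrightarrow> (gradf z + d) \<bullet> (x - z) \<ge> 0"
    using subgradient_of_constrained_minimum[OF convex_separable_sum[OF g] convex_feasible[OF X_convex] zF]
    by metis
  then show ?thesis using zF by (auto simp: stationary_def)
qed

section \<open>Trajectories\<close>

text \<open>A recursion in \<open>disp\<close> alone, with no choice of minimisers left; in the
  randomized case it is used path by path.\<close>

definition run :: "(nat \<Rightarrow> real) \<Rightarrow> (nat \<Rightarrow> 'n set) \<Rightarrow> (nat \<Rightarrow> real ^ 'k) \<Rightarrow> bool" where
  "run \<gamma> S x \<longleftrightarrow> (\<forall>r. x r \<in> Dom \<and> 0 < \<gamma> r \<and> \<gamma> r \<le> 1 \<and>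
     x (Suc r) = x r + \<gamma> r *\<^sub>R blocks blk (S r) (disp (x r)))"

lemma run_shift: "run \<gamma> S x \<Longrightarrow> run (\<lambda>r. \<gamma> (r + k)) (\<lambda>r. S (r + k)) (\<lambda>r. x (r + k))"
  by (simp add: run_def)

lemma run_of_iterates:
  assumes it: "psca_iterates blk X ft g \<gamma> x0 S x" and x0: "x0 \<in> F"
    and \<gamma>: "\<And>r. 0 < \<gamma> r" "\<And>r. \<gamma> r \<le> 1"
  shows "run \<gamma> S x"
proof -
  have step: "x r \<in> Dom \<and> x (Suc r) = x r + \<gamma> r *\<^sub>R blocks blk (S r) (disp (x r))" if xr: "x r \<in> F" for r
  proof -
    have "\<forall>i. \<exists>a. is_arg_min (\<lambda>u. ft i u (x r) + g i u) (\<lambda>u. u \<in> X i) a \<and>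
        bl i (x (Suc r)) = (if i \<in> S r then bl i (x r) + \<gamma> r *\<^sub>R (a - bl i (x r)) else bl i (x r))"
      using it unfolding psca_iterates_def by blast
    from choice[OF this] obtain a
      where a: "\<And>i. is_arg_min (\<lambda>u. ft i u (x r) + g i u) (\<lambda>u. u \<in> X i) (a i)"
      and next_block: "\<And>i. bl i (x (Suc r)) =
          (if i \<in> S r then bl i (x r) + \<gamma> r *\<^sub>R (a i - bl i (x r)) else bl i (x r))"
      by blast
    \<comment> \<open>Each \<open>a i\<close> lies in its own coordinate subspace, so the
      \<open>i\<close>-th block of the sum is exactly \<open>a i\<close>.\<close>
    define w where "w = (\<Sum>i\<in>UNIV. a i)"
    have "a i \<in> block_space blk i" for i using a[of i] X_sub by (auto simp: is_arg_min_def)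
    then have self: "bl i (a i) = a i" for i by (rule block_eq_self)
    have "bl i (a j) = (if i = j then a i else 0)" for i j
      using block_block[of blk i j "a j"] by (cases "i = j") (simp_all add: self)
    then have w: "bl i w = a i" for i by (simp add: w_def linear_sum[OF linear_block])
    have resp: "responds (x r) w" unfolding responds_def w by (simp add: a)
    have d: "disp (x r) = w - x r" using xr resp by (rule disp_eqI)
    have "x (Suc r) = x r + \<gamma> r *\<^sub>R blocks blk (S r) (disp (x r))"
      by (rule block_eqI[of blk]) (simp add: next_block d block_simps block_blocks w)
    then show ?thesis using xr resp by (auto simp: Dom_def)
  qed
  \<comment> \<open>Feasibility needs induction: \<open>step\<close> identifies the displacement
    only at a feasible iterate.\<close>
  have "x r \<in> F" for r
  proof (induction r)
    case 0
    then show ?case using it x0 by (simp add: psca_iterates_def)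
  next
    case (Suc r)
    then show ?case using step[of r] \<gamma>[of r] step_mem[of "x r" "\<gamma> r" "S r"] by (simp add: less_imp_le)
  qed
  then show ?thesis using step \<gamma> by (simp add: run_def)
qed

lemma run_stationary:
  assumes run: "run \<gamma> S x" and d: "(\<lambda>r. disp (x r)) \<longlonglongrightarrow> 0" and z: "seq_limit_point x z"
  shows "stationary F gradf G z"
proof -
  obtain s where s: "strict_mono s" "(x \<circ> s) \<longlonglongrightarrow> z" using z by (auto simp: seq_limit_point_def)
  show ?thesis
  proof (rule stationary_limit)
    show "(x \<circ> s) r \<in> Dom" for r using run by (simp add: run_def)
    show "(\<lambda>r. disp ((x \<circ> s) r)) \<longlonglongrightarrow> 0"
      using LIMSEQ_subseq_LIMSEQ[OF d s(1)] by (simp add: o_def)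
  qed (rule s(2))
qed

text \<open>Telescoping of \<open>step_descent\<close>, with \<open>\<kappa>\<close> a uniform lower
  bound for the descent factor.\<close>

lemma run_square_sum:
  assumes run: "run \<gamma> S x" and \<kappa>: "\<kappa> > 0" "\<And>r. \<kappa> \<le> \<tau> - L * \<gamma> r"
  shows "\<kappa> * (\<Sum>r<N. \<gamma> r * (norm (blocks blk (S r) (disp (x r))))\<^sup>2) \<le> h (x 0) - h (x N)"
proof (induction N)
  case (Suc N)
  let ?d = "norm (blocks blk (S N) (disp (x N)))"
  have x: "x N \<in> Dom" "x (Suc N) = x N + \<gamma> N *\<^sub>R blocks blk (S N) (disp (x N))"
    and \<gamma>: "0 \<le> \<gamma> N" "\<gamma> N \<le> 1"
    using run by (auto simp: run_def less_imp_le)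
  have "\<gamma> N * ?d\<^sup>2 * \<kappa> \<le> \<gamma> N * ?d\<^sup>2 * (\<tau> - L * \<gamma> N)" using \<kappa>(2) \<gamma> by (intro mult_left_mono) auto
  moreover have "h (x (Suc N)) \<le> h (x N) - \<gamma> N * (\<tau> - L * \<gamma> N) * ?d\<^sup>2"
    unfolding x(2) by (rule step_descent[OF x(1) \<gamma>])
  ultimately show ?case using Suc by (simp add: algebra_simps)
qed simp

lemma run_square_summable:
  assumes run: "run \<gamma> S x" and \<kappa>: "\<kappa> > 0" "\<And>r. \<kappa> \<le> \<tau> - L * \<gamma> r"
  shows "summable (\<lambda>r. \<gamma> r * (norm (blocks blk (S r) (disp (x r))))\<^sup>2)"
proof -
  obtain b where b: "\<And>x. x \<in> F \<Longrightarrow> b \<le> h x" by (rule h_lower_bound) auto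
  show ?thesis
  proof (rule summableI_nonneg_bounded)
    fix N
    show "0 \<le> \<gamma> N * (norm (blocks blk (S N) (disp (x N))))\<^sup>2"
      using run by (auto simp: run_def less_imp_le)
    have "b \<le> h (x N)" using run by (intro b) (auto simp: run_def Dom_def)
    then show "(\<Sum>r<N. \<gamma> r * (norm (blocks blk (S r) (disp (x r))))\<^sup>2) \<le> (h (x 0) - b) / \<kappa>"
      using run_square_sum[OF run \<kappa>, of N] \<kappa>(1) by (simp add: field_simps)
  qed
qed

lemma run_displacement:
  assumes run: "run \<gamma> S x"
  shows "norm (disp (x (r + n)) - disp (x r))
    \<le> C * (\<Sum>j<n. \<gamma> (r + j) * norm (blocks blk (S (r + j)) (disp (x (r + j)))))"
proof -
  have "norm (x (r + n) - x r) \<le> (\<Sum>j<n. \<gamma> (r + j) * norm (blocks blk (S (r + j)) (disp (x (r + j)))))"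
  proof (induction n)
    case (Suc n)
    have "x (r + Suc n) - x r = (x (r + n) - x r) + \<gamma> (r + n) *\<^sub>R blocks blk (S (r + n)) (disp (x (r + n)))"
      using run by (simp add: run_def)
    also have "norm \<dots> \<le> norm (x (r + n) - x r) + \<gamma> (r + n) * norm (blocks blk (S (r + n)) (disp (x (r + n))))"
      using run by (intro order.trans[OF norm_triangle_ineq]) (auto simp: run_def less_imp_le)
    finally show ?case using Suc by simp
  qed simp
  moreover have "C \<ge> 0" using run C_nonneg[of "x 0"] by (auto simp: run_def Dom_def)
  ultimately have "C * norm (x (r + n) - x r)
      \<le> C * (\<Sum>j<n. \<gamma> (r + j) * norm (blocks blk (S (r + j)) (disp (x (r + j)))))"
    by (rule mult_left_mono)
  then show ?thesis using run disp_lipschitz[of "x (r + n)" "x r"] by (auto simp: run_def)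
qed

text \<open>When the full displacement, and not only its selected part, is square summable with
  weights \<open>\<gamma>\<close>, the slow variation lemma applies to its norm with no error
  term.\<close>

lemma run_disp_tendsto_zero:
  assumes run: "run \<gamma> S x" and div: "\<not> summable \<gamma>"
    and sq: "summable (\<lambda>r. \<gamma> r * (norm (disp (x r)))\<^sup>2)"
  shows "(\<lambda>r. disp (x r)) \<longlonglongrightarrow> 0"
proof -
  define v where "v r = norm (disp (x r))" for r
  have \<gamma>: "0 \<le> \<gamma> r" "\<gamma> r \<le> 1" for r using run by (auto simp: run_def less_imp_le)
  have C: "C \<ge> 0" using run C_nonneg[of "x 0"] by (auto simp: run_def Dom_def)
  have var: "\<bar>v (Suc r) - v r\<bar> \<le> C * (\<gamma> r * v r)" for r
  proof -
    have "\<bar>v (Suc r) - v r\<bar> \<le> norm (disp (x (r + 1)) - disp (x r))"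
      using norm_triangle_ineq3[of "disp (x (Suc r))" "disp (x r)"] by (simp add: v_def)
    also have "\<dots> \<le> C * (\<gamma> r * norm (blocks blk (S r) (disp (x r))))"
      using run_displacement[OF run, of r 1] by simp
    also have "\<dots> \<le> C * (\<gamma> r * v r)"
      unfolding v_def using C \<gamma> by (intro mult_left_mono norm_blocks_le) auto
    finally show ?thesis .
  qed
  have "v \<longlonglongrightarrow> 0"
  proof (rule vanishing_of_slow_variation[where \<epsilon>="\<lambda>_. 0" and \<beta>=\<gamma> and C=C])
    show "summable (\<lambda>r. \<gamma> r * (v r)\<^sup>2)" using sq by (simp add: v_def)
    then have "(\<lambda>r. \<gamma> r * v r) \<longlonglongrightarrow> 0" by (rule tendsto_zero_of_summable_mult_square[OF _ \<gamma>])
    then have "(\<lambda>r. C * (\<gamma> r * v r)) \<longlonglongrightarrow> 0" by (rule tendsto_mult_right_zero)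
    then show "(\<lambda>r. v (Suc r) - v r) \<longlonglongrightarrow> 0"
      by (rule Lim_null_comparison[rotated]) (use var in auto)
  qed (use var \<gamma> C div in \<open>auto simp: v_def mult.assoc\<close>)
  then show ?thesis unfolding v_def by (rule tendsto_norm_zero_cancel)
qed

section \<open>Cyclic selection\<close>

text \<open>
  The quantity that vanishes is the sum \<open>V r\<close> of the displacements over the window of the next
  \<open>m\<close> updates. Periodicity makes its increment a difference of displacements of one and the same set
  of blocks, so it is at most \<open>C * \<gamma> r * V r\<close>, while only \<open>\<gamma> (r + m) * (V r)\<^sup>2\<close> is known to be
  summable. Monotonicity makes the difference \<open>\<gamma> r - \<gamma> (r + m)\<close> summable.
\<close>

lemma cyclic_disp_tendsto_zero:
  assumes run: "run \<gamma> S x" and \<kappa>: "\<kappa> > 0" "\<And>r. \<kappa> \<le> \<tau> - L * \<gamma> r" and div: "\<not> summable \<gamma>"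
    and dec: "decseq \<gamma>" and period: "\<And>r. S (r + m) = S r" and cover: "\<And>r. (\<Union>j<m. S (r + j)) = UNIV"
  shows "(\<lambda>r. disp (x r)) \<longlonglongrightarrow> 0"
proof -
  define d where "d r = norm (blocks blk (S r) (disp (x r)))" for r
  define V where "V r = (\<Sum>j<m. d (r + j))" for r
  have d0: "d r \<ge> 0" for r by (simp add: d_def)
  have V0: "V r \<ge> 0" for r by (simp add: V_def sum_nonneg d0)
  have \<gamma>: "0 \<le> \<gamma> r" "\<gamma> r \<le> 1" for r using run by (auto simp: run_def less_imp_le)
  have C: "C \<ge> 0" using run C_nonneg[of "x 0"] by (auto simp: run_def Dom_def)
  have move: "norm (disp (x (r + n)) - disp (x r)) \<le> C * (\<Sum>j<n. \<gamma> (r + j) * d (r + j))" for r n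
    unfolding d_def by (rule run_displacement[OF run])
  \<comment> \<open>Shifting the window drops its first term and gains one at its end.\<close>
  have V_diff: "V (Suc r) - V r = d (r + m) - d r" for r
  proof -
    have "V (Suc r) + d r = (\<Sum>j<Suc m. d (r + j))"
      unfolding V_def by (subst sum.lessThan_Suc_shift) simp
    then show ?thesis by (simp add: V_def)
  qed
  have incr: "\<bar>V (Suc r) - V r\<bar> \<le> C * (\<Sum>j<m. \<gamma> (r + j) * d (r + j))" for r
  proof -
    have "\<bar>d (r + m) - d r\<bar> \<le> norm (blocks blk (S r) (disp (x (r + m)) - disp (x r)))"
      unfolding d_def period linear_diff[OF linear_blocks] by (rule norm_triangle_ineq3)
    also have "\<dots> \<le> norm (disp (x (r + m)) - disp (x r))" by (rule norm_blocks_le)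
    finally show ?thesis using move[of r m] by (simp add: V_diff)
  qed
  have sq: "summable (\<lambda>r. \<gamma> r * (d r)\<^sup>2)"
    unfolding d_def by (rule run_square_summable[OF run \<kappa>])
  have "V \<longlonglongrightarrow> 0"
  proof (rule vanishing_of_slow_variation[where \<beta>="\<lambda>r. \<gamma> (r + m)" and \<epsilon>="\<lambda>r. C * (\<gamma> r - \<gamma> (r + m))" and C=C])
    show "\<not> summable (\<lambda>r. \<gamma> (r + m))" using div by (simp add: summable_iff_shift)
    show "0 \<le> C * (\<gamma> r - \<gamma> (r + m))" for r using C decseqD[OF dec, of r "r + m"] by simp
    show "summable (\<lambda>r. \<gamma> (r + m) * (V r)\<^sup>2)"
    proof (rule summable_comparison_test')
      show "summable (\<lambda>r. real m * (\<Sum>j<m. \<gamma> (r + j) * (d (r + j))\<^sup>2))"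
        by (intro summable_mult summable_sum summable_ignore_initial_segment[OF sq])
      fix r
      \<comment> \<open>Cauchy-Schwarz over the \<open>m\<close> terms of the window.\<close>
      have "(V r)\<^sup>2 \<le> real m * (\<Sum>j<m. (d (r + j))\<^sup>2)"
        using Cauchy_Schwarz_ineq_sum[of "\<lambda>_. 1" "\<lambda>j. d (r + j)" "{..<m}"] by (simp add: V_def)
      then have "\<gamma> (r + m) * (V r)\<^sup>2 \<le> \<gamma> (r + m) * (real m * (\<Sum>j<m. (d (r + j))\<^sup>2))"
        using \<gamma> by (intro mult_left_mono)
      also have "\<dots> = real m * (\<Sum>j<m. \<gamma> (r + m) * (d (r + j))\<^sup>2)"
        by (simp add: sum_distrib_left algebra_simps)
      also have "\<dots> \<le> real m * (\<Sum>j<m. \<gamma> (r + j) * (d (r + j))\<^sup>2)"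
        using decseqD[OF dec] by (intro mult_left_mono sum_mono mult_right_mono) auto
      finally show "norm (\<gamma> (r + m) * (V r)\<^sup>2) \<le> real m * (\<Sum>j<m. \<gamma> (r + j) * (d (r + j))\<^sup>2)"
        using \<gamma> by simp
    qed
    show "summable (\<lambda>r. C * (\<gamma> r - \<gamma> (r + m)))"
    proof (intro summable_mult)
      have "\<forall>r. 0 \<le> \<gamma> r" using \<gamma>(1) by blast
      from decseq_convergent[OF dec this] obtain l where "\<gamma> \<longlonglongrightarrow> l" by blast
      then have "summable (\<lambda>r. \<gamma> r - \<gamma> (Suc r))" by (rule telescope_summable')
      then have "summable (\<lambda>r. \<gamma> (r + j) - \<gamma> (Suc (r + j)))" for j
        by (rule summable_ignore_initial_segment)
      then have "summable (\<lambda>r. \<Sum>j<m. \<gamma> (r + j) - \<gamma> (Suc (r + j)))" by (intro summable_sum)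
      \<comment> \<open>The difference over a whole period is a sum of \<open>m\<close> shifted
        one-step differences, each summable since \<open>\<gamma>\<close> converges.\<close>
      moreover have "(\<Sum>j<m. \<gamma> (r + j) - \<gamma> (Suc (r + j))) = \<gamma> r - \<gamma> (r + m)" for r
        using sum_lessThan_telescope'[of "\<lambda>j. \<gamma> (r + j)" m] by simp
      ultimately show "summable (\<lambda>r. \<gamma> r - \<gamma> (r + m))" by simp
    qed
    show "\<bar>V (Suc r) - V r\<bar> \<le> (C * \<gamma> (r + m) + C * (\<gamma> r - \<gamma> (r + m))) * V r" for r
    proof -
      have "(\<Sum>j<m. \<gamma> (r + j) * d (r + j)) \<le> \<gamma> r * V r"
        unfolding V_def sum_distrib_left
        using decseqD[OF dec] d0 by (intro sum_mono mult_right_mono) auto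
      then have "C * (\<Sum>j<m. \<gamma> (r + j) * d (r + j)) \<le> C * (\<gamma> r * V r)" using C by (rule mult_left_mono)
      then show ?thesis using incr[of r] by (simp add: algebra_simps)
    qed
    have "(\<lambda>r. \<gamma> r * d r) \<longlonglongrightarrow> 0" by (rule tendsto_zero_of_summable_mult_square[OF sq \<gamma>])
    then have "(\<lambda>r. \<gamma> (r + j) * d (r + j)) \<longlonglongrightarrow> 0" for j by (rule LIMSEQ_ignore_initial_segment)
    then have "(\<lambda>r. C * (\<Sum>j<m. \<gamma> (r + j) * d (r + j))) \<longlonglongrightarrow> 0"
      by (intro tendsto_mult_right_zero tendsto_null_sum)
    then show "(\<lambda>r. V (Suc r) - V r) \<longlonglongrightarrow> 0"
      by (rule Lim_null_comparison[rotated]) (use incr in auto)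
  qed (use V0 C \<gamma> in auto)
  then have lim: "(\<lambda>r. real CARD('n) * ((1 + C) * V r)) \<longlonglongrightarrow> 0" by (intro tendsto_mult_right_zero)
  \<comment> \<open>Each block is selected somewhere in the window. Its displacement at that time is
    at most \<open>V r\<close>, and going back to time \<open>r\<close> changes it by at most
    \<open>C * V r\<close>.\<close>
  have "norm (disp (x r)) \<le> real CARD('n) * ((1 + C) * V r)" for r
  proof -
    have "norm (bl i (disp (x r))) \<le> (1 + C) * V r" for i
    proof -
      obtain j where j: "j < m" "i \<in> S (r + j)" using cover[of r] by blast
      have "norm (bl i (disp (x r))) \<le> norm (bl i (disp (x (r + j)))) + norm (bl i (disp (x (r + j)) - disp (x r)))"
        using norm_triangle_ineq4[of "bl i (disp (x (r + j)))" "bl i (disp (x (r + j)) - disp (x r))"]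
        by (simp add: block_simps)
      also have "norm (bl i (disp (x (r + j)))) \<le> d (r + j)" unfolding d_def by (rule norm_block_le_blocks[OF j(2)])
      also have "d (r + j) \<le> V r" unfolding V_def using j(1) d0 by (intro member_le_sum) auto
      also have "norm (bl i (disp (x (r + j)) - disp (x r))) \<le> norm (disp (x (r + j)) - disp (x r))"
        by (rule norm_block_le)
      also have "\<dots> \<le> C * (\<Sum>l<j. \<gamma> (r + l) * d (r + l))" by (rule move)
      also have "\<dots> \<le> C * (\<Sum>l<j. d (r + l))"
        using C \<gamma> d0 by (intro mult_left_mono sum_mono) (auto intro: mult_left_le_one_le)
      also have "\<dots> \<le> C * V r"
        unfolding V_def using C d0 j(1) by (intro mult_left_mono sum_mono2) auto
      finally show ?thesis by (simp add: algebra_simps)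
    qed
    then have "(\<Sum>i\<in>(UNIV :: 'n set). norm (bl i (disp (x r)))) \<le> (\<Sum>i\<in>(UNIV :: 'n set). (1 + C) * V r)"
      by (rule sum_mono)
    then show ?thesis using norm_le_sum_blocks[of "disp (x r)" blk] by simp
  qed
  then show ?thesis by (intro Lim_null_comparison[OF _ lim]) auto
qed

section \<open>Randomized selection\<close>

text \<open>The start and the step sizes are deterministic, so the only randomness in one step is
  the selected set, which has finitely many values.\<close>

lemma finite_range_iterates:
  assumes run: "\<And>\<omega>. \<omega> \<in> \<Omega> \<Longrightarrow> run \<gamma> (\<lambda>r. S r \<omega>) (\<lambda>r. x r \<omega>)"
    and x0: "\<And>\<omega>. \<omega> \<in> \<Omega> \<Longrightarrow> x 0 \<omega> = x0"
  shows "finite (x r ` \<Omega>)"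
proof (induction r)
  case 0
  have "x 0 ` \<Omega> \<subseteq> {x0}" using x0 by auto
  then show ?case by (rule finite_subset) simp
next
  case (Suc r)
  have "x (Suc r) ` \<Omega> \<subseteq> (\<lambda>(y, T). y + \<gamma> r *\<^sub>R blocks blk T (disp y)) ` (x r ` \<Omega> \<times> UNIV)"
    using run by (force simp: run_def)
  then show ?case by (rule finite_subset) (intro finite_imageI finite_cartesian_product Suc finite)
qed

text \<open>The squared displacement of block \<open>j\<close> is determined by the history, so in
  expectation its selection indicator may be replaced by the conditional probability, which is at
  least \<open>pmin\<close>. Summing over \<open>j\<close> compares the full and the selected
  displacement.\<close>

lemma randomized_expected_decrease:
  assumes M: "prob_space M" and rule: "randomized_rule M S x"
    and fin: "\<And>r. finite (x r ` space M)"
  obtains pmin where "pmin > 0"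
    and "\<And>r. integrable M (\<lambda>\<omega>. (norm (disp (x r \<omega>)))\<^sup>2)"
    and "\<And>r. integrable M (\<lambda>\<omega>. (norm (blocks blk (S r \<omega>) (disp (x r \<omega>))))\<^sup>2)"
    and "\<And>r. pmin * (\<integral>\<omega>. (norm (disp (x r \<omega>)))\<^sup>2 \<partial>M)
      \<le> (\<integral>\<omega>. (norm (blocks blk (S r \<omega>) (disp (x r \<omega>))))\<^sup>2 \<partial>M)"
proof -
  interpret prob_space M by fact
  have S[measurable]: "S r \<in> measurable M (count_space UNIV)" and x: "x r \<in> borel_measurable M" for r
    using rule by (auto simp: randomized_rule_def)
  obtain p pmin where pmin: "pmin > 0" and p: "\<And>r j. AE \<omega> in M.
      real_cond_exp M (history M x r) (indicat_real {\<omega> \<in> space M. j \<in> S r \<omega>}) \<omega> = p r j \<omega> \<and> p r j \<omega> \<ge> pmin"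
    using rule unfolding randomized_rule_def by blast
  have sub: "subalgebra M (history M x r)" for r using x by (rule history_subalgebra)
  \<comment> \<open>Finite range is what allows an arbitrary \<open>\<phi>\<close> here, measurable
    or not.\<close>
  have simple: "simple_function (history M x r) (\<lambda>\<omega>. \<phi> (x r \<omega>))" for r and \<phi> :: "real ^ 'k \<Rightarrow> real"
    by (rule simple_function_compose1[of _ "x r" \<phi>], rule simple_function_finite_range[OF measurable_history])
       (use sub[of r] fin[of r] in \<open>simp add: subalgebra_def\<close>)
  have meas: "(\<lambda>\<omega>. \<phi> (x r \<omega>)) \<in> borel_measurable (history M x r)" for r and \<phi> :: "real ^ 'k \<Rightarrow> real"
    by (rule borel_measurable_simple_function[OF simple])
  have int: "integrable M (\<lambda>\<omega>. \<phi> (x r \<omega>))" for r and \<phi> :: "real ^ 'k \<Rightarrow> real"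
    by (rule integrable_simple_function_finite, rule simple_function_compose1[of _ "x r" \<phi>],
        rule simple_function_finite_range[OF x fin])
  define q where "q i y = (norm (bl i (disp y)))\<^sup>2" for i y
  have norm_disp: "(norm (disp y))\<^sup>2 = (\<Sum>j\<in>UNIV. q j y)" for y
    unfolding q_def by (rule norm_sq_eq_sum_blocks)
  define I where "I r j = indicat_real {\<omega> \<in> space M. j \<in> S r \<omega>}" for r j
  have I[measurable]: "I r j \<in> borel_measurable M" for r j
    unfolding I_def by measurable
  have intI: "integrable M (\<lambda>\<omega>. q j (x r \<omega>) * I r j \<omega>)" for r j
    by (rule Bochner_Integration.integrable_bound[OF int[of "q j" r]])
       (use int[of "q j" r] in \<open>auto simp: I_def q_def indicator_def\<close>)
  have decrease: "pmin * (\<integral>\<omega>. q j (x r \<omega>) \<partial>M) \<le> (\<integral>\<omega>. q j (x r \<omega>) * I r j \<omega> \<partial>M)" for r j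
  proof -
    interpret finite_measure_subalgebra M "history M x r" by standard (rule sub)
    have "pmin * (\<integral>\<omega>. q j (x r \<omega>) \<partial>M) = (\<integral>\<omega>. q j (x r \<omega>) * pmin \<partial>M)" by simp
    also have "\<dots> \<le> (\<integral>\<omega>. q j (x r \<omega>) * real_cond_exp M (history M x r) (I r j) \<omega> \<partial>M)"
    proof (rule integral_mono_AE)
      show "AE \<omega> in M. q j (x r \<omega>) * pmin \<le> q j (x r \<omega>) * real_cond_exp M (history M x r) (I r j) \<omega>"
        using p[of r j] unfolding I_def by eventually_elim (auto simp: q_def intro!: mult_left_mono)
    qed (auto intro!: int real_cond_exp_intg(1)[OF intI meas I])
    \<comment> \<open>Defining property of the conditional expectation against the
      history-measurable factor \<open>q j (x r \<omega>)\<close>.\<close>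
    also have "\<dots> = (\<integral>\<omega>. q j (x r \<omega>) * I r j \<omega> \<partial>M)"
      by (rule real_cond_exp_intg(2)[OF intI meas I])
    finally show ?thesis .
  qed
  have e: "(norm (blocks blk (S r \<omega>) (disp (x r \<omega>))))\<^sup>2 = (\<Sum>j\<in>UNIV. q j (x r \<omega>) * I r j \<omega>)"
    if "\<omega> \<in> space M" for r \<omega>
  proof -
    have "(\<Sum>j\<in>UNIV. q j (x r \<omega>) * I r j \<omega>) = (\<Sum>j\<in>UNIV. if j \<in> S r \<omega> then q j (x r \<omega>) else 0)"
      using that by (intro sum.cong) (auto simp: I_def)
    then show ?thesis by (simp add: norm_blocks_sq q_def sum.If_cases)
  qed
  show ?thesis
  proof (rule that[OF pmin])
    fix r
    show "integrable M (\<lambda>\<omega>. (norm (disp (x r \<omega>)))\<^sup>2)" by (rule int)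
    show "integrable M (\<lambda>\<omega>. (norm (blocks blk (S r \<omega>) (disp (x r \<omega>))))\<^sup>2)"
      by (subst Bochner_Integration.integrable_cong[OF refl e]) (auto intro!: Bochner_Integration.integrable_sum intI)
    have "pmin * (\<integral>\<omega>. (norm (disp (x r \<omega>)))\<^sup>2 \<partial>M) = (\<Sum>j\<in>UNIV. pmin * (\<integral>\<omega>. q j (x r \<omega>) \<partial>M))"
      unfolding norm_disp by (simp add: Bochner_Integration.integral_sum int sum_distrib_left)
    also have "\<dots> \<le> (\<Sum>j\<in>UNIV. \<integral>\<omega>. q j (x r \<omega>) * I r j \<omega> \<partial>M)" by (intro sum_mono decrease)
    also have "\<dots> = (\<integral>\<omega>. (norm (blocks blk (S r \<omega>) (disp (x r \<omega>))))\<^sup>2 \<partial>M)"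
      by (subst Bochner_Integration.integral_cong[OF refl e])
         (auto simp: Bochner_Integration.integral_sum intI)
    finally show "pmin * (\<integral>\<omega>. (norm (disp (x r \<omega>)))\<^sup>2 \<partial>M)
      \<le> (\<integral>\<omega>. (norm (blocks blk (S r \<omega>) (disp (x r \<omega>))))\<^sup>2 \<partial>M)" .
  qed
qed

text \<open>Descent bounds the selected squares on every path; in expectation this bounds the full
  squares, which are therefore summable on almost every path. There the deterministic lemma applies.
  The shift by \<open>r0\<close> reaches the range where the margin \<open>\<kappa>\<close> is
  available.\<close>

lemma randomized_disp_tendsto_zero:
  assumes M: "prob_space M" and rule: "randomized_rule M S x"
    and run: "\<And>\<omega>. \<omega> \<in> space M \<Longrightarrow> run \<gamma> (\<lambda>r. S r \<omega>) (\<lambda>r. x r \<omega>)"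
    and x0: "\<And>\<omega>. \<omega> \<in> space M \<Longrightarrow> x 0 \<omega> = x0"
    and \<gamma>: "\<And>r. 0 < \<gamma> r" and div: "\<not> summable \<gamma>"
    and \<kappa>: "\<kappa> > 0" "\<And>r. r \<ge> r0 \<Longrightarrow> \<kappa> \<le> \<tau> - L * \<gamma> r"
  shows "AE \<omega> in M. (\<lambda>r. disp (x r \<omega>)) \<longlonglongrightarrow> 0"
proof -
  interpret prob_space M by fact
  have fin: "finite (x r ` space M)" for r using run x0 by (rule finite_range_iterates)
  let ?d = "\<lambda>r \<omega>. (norm (disp (x r \<omega>)))\<^sup>2"
  let ?e = "\<lambda>r \<omega>. (norm (blocks blk (S r \<omega>) (disp (x r \<omega>))))\<^sup>2"
  obtain pmin where pmin: "pmin > 0" and int_d: "\<And>r. integrable M (?d r)" and int_e: "\<And>r. integrable M (?e r)"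
    and decrease: "\<And>r. pmin * (\<integral>\<omega>. ?d r \<omega> \<partial>M) \<le> (\<integral>\<omega>. ?e r \<omega> \<partial>M)"
    using randomized_expected_decrease[OF M rule fin] by blast
  obtain b where b: "\<And>x. x \<in> F \<Longrightarrow> b \<le> h x" by (rule h_lower_bound) auto
  \<comment> \<open>Finite range bounds the objective at time \<open>r0\<close> on all paths at
    once, so the descent bound is uniform in the outcome.\<close>
  have "bounded (h ` x r0 ` space M)" by (intro finite_imp_bounded finite_imageI fin)
  then obtain B where "\<forall>\<omega>\<in>space M. \<bar>h (x r0 \<omega>)\<bar> \<le> B" by (auto simp: bounded_iff)
  then have B: "\<And>\<omega>. \<omega> \<in> space M \<Longrightarrow> h (x r0 \<omega>) \<le> B" by (auto simp: abs_le_iff)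
  have path: "(\<Sum>r<N. \<gamma> (r + r0) * ?e (r + r0) \<omega>) \<le> (B - b) / \<kappa>" if \<omega>: "\<omega> \<in> space M" for N \<omega>
  proof -
    have "\<kappa> * (\<Sum>r<N. \<gamma> (r + r0) * ?e (r + r0) \<omega>) \<le> h (x (0 + r0) \<omega>) - h (x (N + r0) \<omega>)"
      by (rule run_square_sum[OF run_shift[OF run[OF \<omega>]]]) (use \<kappa> in auto)
    moreover have "b \<le> h (x (N + r0) \<omega>)" using run[OF \<omega>] by (intro b) (auto simp: run_def Dom_def)
    ultimately show ?thesis using B[OF \<omega>] \<kappa>(1) by (simp add: field_simps)
  qed
  have "AE \<omega> in M. summable (\<lambda>r. \<gamma> (r + r0) * ?d (r + r0) \<omega>)"
  proof (rule AE_summable_of_bounded_integrals)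
    fix N
    have "pmin * (\<Sum>r<N. \<integral>\<omega>. \<gamma> (r + r0) * ?d (r + r0) \<omega> \<partial>M)
        = (\<Sum>r<N. \<gamma> (r + r0) * (pmin * (\<integral>\<omega>. ?d (r + r0) \<omega> \<partial>M)))"
      by (simp add: sum_distrib_left algebra_simps)
    also have "\<dots> \<le> (\<Sum>r<N. \<gamma> (r + r0) * (\<integral>\<omega>. ?e (r + r0) \<omega> \<partial>M))"
      by (intro sum_mono mult_left_mono decrease less_imp_le \<gamma>)
    also have "\<dots> = (\<integral>\<omega>. (\<Sum>r<N. \<gamma> (r + r0) * ?e (r + r0) \<omega>) \<partial>M)"
      by (simp add: Bochner_Integration.integral_sum int_e)
    also have "\<dots> \<le> (\<integral>\<omega>. (B - b) / \<kappa> \<partial>M)"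
      by (intro integral_mono path) (auto intro!: Bochner_Integration.integrable_sum int_e)
    also have "\<dots> = (B - b) / \<kappa>" by (simp add: prob_space)
    finally show "(\<Sum>r<N. \<integral>\<omega>. \<gamma> (r + r0) * ?d (r + r0) \<omega> \<partial>M) \<le> (B - b) / \<kappa> / pmin"
      using pmin by (simp only: pos_le_divide_eq mult.commute)
  qed (use \<gamma> in \<open>auto intro!: int_d simp: less_imp_le\<close>)
  then have "AE \<omega> in M. \<omega> \<in> space M \<and> summable (\<lambda>r. \<gamma> (r + r0) * ?d (r + r0) \<omega>)"
    by (simp add: AE_space)
  then show ?thesis
  proof eventually_elim
    case (elim \<omega>)
    then have "(\<lambda>r. disp (x (r + r0) \<omega>)) \<longlonglongrightarrow> 0"
      using div by (intro run_disp_tendsto_zero[OF run_shift[OF run]]) (simp_all add: summable_iff_shift)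
    then show ?case by (rule LIMSEQ_offset)
  qed
qed

end

section \<open>Consequences of the selection and step-size hypotheses\<close>

lemma cyclic_rule_periodic:
  assumes "cyclic_rule S"
  obtains m where "\<And>r. S (r + m) = S r" and "\<And>r. (\<Union>j<m. S (r + j)) = UNIV"
proof -
  obtain m T where m: "m > 0" and T: "(\<Union>l<m. T l) = UNIV" and S: "\<And>r l. l < m \<Longrightarrow> S (m * r + l) = T l"
    using assms by (auto simp: cyclic_rule_def)
  have S': "S r = T (r mod m)" for r
    using S[of "r mod m" "r div m"] m by simp
  show ?thesis
  proof
    show "S (r + m) = S r" for r by (simp add: S')
    fix r
    show "(\<Union>j<m. S (r + j)) = UNIV"
    proof (intro equalityI subsetI)
      fix i
      obtain l where l: "l < m" "i \<in> T l" using T by blast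
      \<comment> \<open>The residue of \<open>l - r\<close> modulo \<open>m\<close>; adding
        \<open>m\<close> first keeps the subtraction of natural numbers from truncating.\<close>
      define j where "j = (l + m - r mod m) mod m"
      have "(r + j) mod m = (r mod m + (l + m - r mod m)) mod m"
        unfolding j_def by (simp add: mod_simps)
      also have "\<dots> = l" using l m by (simp add: le_add_diff_inverse less_imp_le trans_le_add2)
      finally have "i \<in> S (r + j)" using l by (simp add: S')
      moreover have "j < m" using m by (simp add: j_def)
      ultimately show "i \<in> (\<Union>j<m. S (r + j))" by blast
    qed simp
  qed
qed

text \<open>For \<open>L > 0\<close> a number \<open>c\<close> strictly between the limit superior
  and \<open>\<tau> / L\<close> eventually bounds the steps, with margin
  \<open>\<tau> - L * c\<close>. For \<open>L = 0\<close> the quotient is infinite and the margin is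
  \<open>\<tau>\<close> itself.\<close>

lemma uniform_step_margin:
  assumes L: "L \<ge> 0" and \<tau>: "\<tau> > 0" and lim: "limsup (\<lambda>r. ereal (\<gamma> r)) < ereal \<tau> / ereal L"
  obtains \<kappa> r0 where "\<kappa> > 0" and "\<And>r. r \<ge> r0 \<Longrightarrow> \<kappa> \<le> \<tau> - L * \<gamma> r"
proof (cases "L = 0")
  case True
  then show ?thesis using \<tau> that[of \<tau> 0] by simp
next
  case False
  then have "L > 0" using L by simp
  obtain c where c: "limsup (\<lambda>r. ereal (\<gamma> r)) < ereal c" "ereal c < ereal \<tau> / ereal L"
    using ereal_dense2[OF lim] by blast
  then have "L * c < \<tau>" using \<open>L > 0\<close> by (simp add: field_simps)
  moreover obtain r0 where "\<And>r. r \<ge> r0 \<Longrightarrow> \<gamma> r < c"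
    using Limsup_lessD[OF c(1)] by (auto simp: eventually_sequentially)
  ultimately show ?thesis
    using \<open>L > 0\<close> by (intro that[of "\<tau> - L * c" r0]) (auto simp: less_imp_le)
qed

lemma not_summable_of_sum_at_top:
  fixes \<gamma> :: "nat \<Rightarrow> real"
  assumes "filterlim (\<lambda>N. \<Sum>r=1..N. \<gamma> r) at_top sequentially"
  shows "\<not> summable \<gamma>"
proof
  assume "summable \<gamma>"
  then have "(\<lambda>N. \<Sum>r<N. \<gamma> r) \<longlonglongrightarrow> suminf \<gamma>" by (rule summable_LIMSEQ)
  \<comment> \<open>The sums in the hypothesis start at index 1, so the term
    \<open>\<gamma> 0\<close> is split off.\<close>
  then have "(\<lambda>N. (\<Sum>r<Suc N. \<gamma> r) - \<gamma> 0) \<longlonglongrightarrow> suminf \<gamma> - \<gamma> 0"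
    by (intro tendsto_diff tendsto_const) (rule LIMSEQ_Suc)
  moreover have "(\<Sum>r<Suc N. \<gamma> r) - \<gamma> 0 = (\<Sum>r=1..N. \<gamma> r)" for N
    by (subst sum.lessThan_Suc_shift) (simp add: sum.atLeast1_atMost_eq)
  ultimately have "(\<lambda>N. \<Sum>r=1..N. \<gamma> r) \<longlonglongrightarrow> suminf \<gamma> - \<gamma> 0" by simp
  then show False using assms not_tendsto_and_filterlim_at_infinity[OF sequentially_bot]
    filterlim_at_top_imp_at_infinity by blast
qed

theorem theorem1:
  fixes blk :: "'k::finite \<Rightarrow> 'n::finite"
    and X :: "'n \<Rightarrow> (real ^ 'k) set"
    and f :: "real ^ 'k \<Rightarrow> real" and gradf :: "real ^ 'k \<Rightarrow> real ^ 'k"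
    and g :: "'n \<Rightarrow> real ^ 'k \<Rightarrow> real"
    and ft :: "'n \<Rightarrow> real ^ 'k \<Rightarrow> real ^ 'k \<Rightarrow> real"
    and gradft :: "'n \<Rightarrow> real ^ 'k \<Rightarrow> real ^ 'k \<Rightarrow> real ^ 'k"
    and L Lt \<tau> :: real and \<gamma> :: "nat \<Rightarrow> real" and x0 :: "real ^ 'k"
    and M :: "'w measure"
  assumes X: "\<And>i. X i \<subseteq> block_space blk i" "\<And>i. X i \<noteq> {}" "\<And>i. closed (X i)" "\<And>i. convex (X i)"
    and f: "C1_on_with_gradient (feasible blk X) f gradf"
    and f_lip: "L-lipschitz_on (feasible blk X) gradf"
    and g: "\<And>i. convex_on (block_space blk i) (g i)"
    and h_bdd: "bdd_below ((\<lambda>x. f x + separable_sum blk g x) ` feasible blk X)"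
    and ft: "\<And>i y. y \<in> feasible blk X \<Longrightarrow> C1_on_with_gradient (X i) (\<lambda>u. ft i u y) (\<lambda>u. gradft i u y)"
    and gradft: "\<And>i u y. u \<in> X i \<Longrightarrow> y \<in> feasible blk X \<Longrightarrow> gradft i u y \<in> block_space blk i"
    and tau: "\<tau> > 0"
    and strong: "\<And>i u v y. u \<in> X i \<Longrightarrow> v \<in> X i \<Longrightarrow> y \<in> feasible blk X \<Longrightarrow>
        ft i u y \<ge> ft i v y + gradft i v y \<bullet> (u - v) + \<tau> / 2 * (norm (u - v))\<^sup>2"
    and consistent: "\<And>i x. x \<in> feasible blk X \<Longrightarrow> gradft i (block blk i x) x = block blk i (gradf x)"
    and ft_lip: "\<And>i u. u \<in> X i \<Longrightarrow> Lt-lipschitz_on (feasible blk X) (\<lambda>y. gradft i u y)"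
    and x0: "x0 \<in> feasible blk X"
    and step: "\<And>r. 0 < \<gamma> r" "\<And>r. \<gamma> r \<le> 1"
    and step_sum: "filterlim (\<lambda>N. \<Sum>r=1..N. \<gamma> r) at_top sequentially"
    and step_limsup: "limsup (\<lambda>r. ereal (\<gamma> r)) <
        min (ereal \<tau> / ereal L) (ereal \<tau> / ereal (\<tau> + Lt * sqrt (real CARD('n))))"
  shows "(\<forall>S x. psca_iterates blk X ft g \<gamma> x0 S x \<and> cyclic_rule S \<and> decseq (\<lambda>r. \<gamma> (Suc r)) \<longrightarrow>
           (\<forall>z. seq_limit_point x z \<longrightarrow>
              stationary (feasible blk X) gradf (separable_sum blk g) z)) \<and>
         (\<forall>S x. prob_space M \<and> randomized_rule M S x \<and>
             (\<forall>\<omega>\<in>space M. psca_iterates blk X ft g \<gamma> x0 (\<lambda>r. S r \<omega>) (\<lambda>r. x r \<omega>)) \<longrightarrow>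
           (AE \<omega> in M. \<forall>z. seq_limit_point (\<lambda>r. x r \<omega>) z \<longrightarrow>
              stationary (feasible blk X) gradf (separable_sum blk g) z))"
proof -
  interpret psca blk X f gradf g ft gradft L Lt \<tau>
    using X f f_lip g h_bdd ft tau strong consistent ft_lip by unfold_locales
  have div: "\<not> summable \<gamma>" using step_sum by (rule not_summable_of_sum_at_top)
  have "limsup (\<lambda>r. ereal (\<gamma> r)) < ereal \<tau> / ereal L" using step_limsup by simp
  then obtain \<kappa> r0 where \<kappa>: "\<kappa> > 0" "\<And>r. r \<ge> r0 \<Longrightarrow> \<kappa> \<le> \<tau> - L * \<gamma> r"
    using uniform_step_margin[OF L_nonneg tau] by blast
  show ?thesis
  proof (intro conjI allI impI; elim conjE)
    fix S x z
    assume it: "psca_iterates blk X ft g \<gamma> x0 S x" and cyc: "cyclic_rule S"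
      and dec: "decseq (\<lambda>r. \<gamma> (Suc r))" and z: "seq_limit_point x z"
    have run: "run \<gamma> S x" using it x0 step by (rule run_of_iterates)
    obtain m where m: "\<And>r. S (r + m) = S r" "\<And>r. (\<Union>j<m. S (r + j)) = UNIV"
      using cyclic_rule_periodic[OF cyc] by blast
    \<comment> \<open>The shift by \<open>r0\<close> secures the margin \<open>\<kappa>\<close>; the
      extra 1 is there because monotonicity is assumed from index 1 on.\<close>
    have "(\<lambda>r. disp (x (r + Suc r0))) \<longlonglongrightarrow> 0"
    proof (rule cyclic_disp_tendsto_zero[OF run_shift[OF run] \<kappa>(1)])
      show "\<kappa> \<le> \<tau> - L * \<gamma> (r + Suc r0)" for r by (rule \<kappa>(2)) simp
      show "\<not> summable (\<lambda>r. \<gamma> (r + Suc r0))" using div by (subst summable_iff_shift)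
      show "decseq (\<lambda>r. \<gamma> (r + Suc r0))" using dec by (auto simp: decseq_def)
      show "S (r + m + Suc r0) = S (r + Suc r0)" for r using m(1)[of "r + Suc r0"] by (simp add: ac_simps)
      show "(\<Union>j<m. S (r + j + Suc r0)) = UNIV" for r using m(2)[of "r + Suc r0"] by (simp add: ac_simps)
    qed
    then have "(\<lambda>r. disp (x r)) \<longlonglongrightarrow> 0" by (rule LIMSEQ_offset)
    then show "stationary (feasible blk X) gradf (separable_sum blk g) z"
      using run_stationary[OF run _ z] by blast
  next
    fix S x
    assume M: "prob_space M" and rule: "randomized_rule M S x"
      and it: "\<forall>\<omega>\<in>space M. psca_iterates blk X ft g \<gamma> x0 (\<lambda>r. S r \<omega>) (\<lambda>r. x r \<omega>)"
    have run: "run \<gamma> (\<lambda>r. S r \<omega>) (\<lambda>r. x r \<omega>)" if "\<omega> \<in> space M" for \<omega>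
      using it that x0 step by (intro run_of_iterates) auto
    have start: "x 0 \<omega> = x0" if "\<omega> \<in> space M" for \<omega>
      using bspec[OF it that] by (simp add: psca_iterates_def)
    have "AE \<omega> in M. (\<lambda>r. disp (x r \<omega>)) \<longlonglongrightarrow> 0"
      using M rule run start step(1) div \<kappa> by (rule randomized_disp_tendsto_zero)
    \<comment> \<open>Membership in \<open>space M\<close> is carried along because the iterates are
      runs only for such outcomes.\<close>
    then have "AE \<omega> in M. \<omega> \<in> space M \<and> (\<lambda>r. disp (x r \<omega>)) \<longlonglongrightarrow> 0"
      by (simp add: AE_space)
    then show "AE \<omega> in M. \<forall>z. seq_limit_point (\<lambda>r. x r \<omega>) z \<longrightarrow>
        stationary (feasible blk X) gradf (separable_sum blk g) z"
      by eventually_elim (use run_stationary[OF run] in blast)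
  qed
qed

end
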